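(* Let $\mu$ be a probability measure on $\mathbb{R}$ with a positive density $f$ on $\mathbb{R}$ and cumulative distribution function $F$, with median $m$. Let $p\in[1,+\infty)$, $p^{-1}+q^{-1}=1$, and let $g\in L_p(F)$ and $h\in L_q(F)$ be absolutely continuous. Then $$|\operatorname{Cov}(g,h)|\le [Is(\mu)]^{-1}\|g'\|_p\,\|T_m(h_0)\|_q .$$ Consequently, also $$|\operatorname{Cov}(g,h)|\le p\,[Is(\mu)]^{-1}\|g'\|_p\,\|h_0\|_q .$$
   Context: All norms, expectations and covariances are with respect to $\mu$: $\mathbb{E}[h]=\int h\,d\mu$, $\operatorname{Cov}(g,h)=\int g(h-\mathbb{E}[h])\,d\mu$, $h_0:=h-\mathbb{E}[h]$, and $\|\cdot\|_p$ is the norm of $L_p(F)=L_p(\mu)$. Absolutely continuous functions on $\mathbb{R}$ are understood to be absolutely continuous on every compact interval. Let $a=\inf\{x:F(x)>0\}$, $b=\sup\{x:F(x)<1\}$. For $k\in[-\infty,+\infty]$ and $x\in(a,b)$, $$T_kh(x)=\mathbf{1}_{(a,k]}(x)\frac{1}{F(x)}\int_{(a,x]}h\,dF+\mathbf{1}_{(k,b)}(x)\frac{1}{1-F(x)}\int_{(x,b)}h\,dF .$$ $Is(\mu)$ is the Cheeger isoperimetric constant: the largest $c\ge 0$ such that $\mu^+(A)\ge c\min\{\mu(A),1-\mu(A)\}$ for all measurable $A\subset\mathbb{R}$, where $\mu^+(A)=\liminf_{h\to0^+}(\mu(A^h)-\mu(A))/h$ and $A^h=\{x:\exists a\in A,\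 |x-a|<h\}$. On $\mathbb{R}$, $Is(\mu)=\operatorname{ess\,inf}_{a<x<b}\frac{f(x)}{\min\{F(x),1-F(x)\}}$ (with respect to Lebesgue measure). If $Is(\mu)=0$, then $Is(\mu)^{-1}=+\infty$ and the inequalities are uninformative. *)

theory Defs
  imports "HOL-Probability.Probability"
begin

definition centered :: "real measure \<Rightarrow> (real \<Rightarrow> real) \<Rightarrow> real \<Rightarrow> real" where
  "centered M h x = h x - (\<integral>y. h y \<partial>M)"

definition cov :: "real measure \<Rightarrow> (real \<Rightarrow> real) \<Rightarrow> (real \<Rightarrow> real) \<Rightarrow> real" where
  "cov M g h = (\<integral>x. g x * centered M h x \<partial>M)"

text \<open>The \<open>L\<^sub>r\<close> norm for \<open>r \<in> [1, \<infinity>]\<close>, with values in \<open>[0, \<infinity>]\<close>.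
  It is also applied to \<^term>\<open>deriv g\<close> for absolutely continuous \<open>g\<close>, whose unspecified values on the
  null set where \<open>g\<close> is not differentiable do not matter.\<close>

definition Lp_norm :: "real measure \<Rightarrow> ennreal \<Rightarrow> (real \<Rightarrow> real) \<Rightarrow> ennreal" where
  "Lp_norm M r f =
    (if r = \<infinity> then esssup M (\<lambda>x. ennreal \<bar>f x\<bar>)
     else let I = (\<integral>\<^sup>+x. ennreal (\<bar>f x\<bar> powr enn2real r) \<partial>M)
          in if I = \<infinity> then \<infinity> else ennreal (enn2real I powr (1 / enn2real r)))"

definition Lp_space :: "real measure \<Rightarrow> ennreal \<Rightarrow> (real \<Rightarrow> real) set" where
  "Lp_space M r = {f \<in> borel_measurable M. Lp_norm M r f < \<infinity>}"

text \<open>A pair \<open>(u, v)\<close> in \<open>D\<close> stands for the interval from \<open>u\<close> to \<open>v\<close>; degenerate pairs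
  \<open>u = v\<close> are allowed and contribute nothing to either sum.\<close>

definition abs_cont_on :: "real \<Rightarrow> real \<Rightarrow> (real \<Rightarrow> real) \<Rightarrow> bool" where
  "abs_cont_on c d f \<longleftrightarrow>
    (\<forall>\<epsilon>>0. \<exists>\<delta>>0. \<forall>D :: (real \<times> real) set.
       finite D \<longrightarrow> (\<forall>(u, v)\<in>D. c \<le> u \<and> u \<le> v \<and> v \<le> d) \<longrightarrow>
       disjoint_family_on (\<lambda>(u, v). {u<..<v}) D \<longrightarrow>
       (\<Sum>(u, v)\<in>D. v - u) < \<delta> \<longrightarrow>
       (\<Sum>(u, v)\<in>D. \<bar>f v - f u\<bar>) < \<epsilon>)"

definition abs_cont :: "(real \<Rightarrow> real) \<Rightarrow> bool" where
  "abs_cont f \<longleftrightarrow> (\<forall>c d. c \<le> d \<longrightarrow> abs_cont_on c d f)"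

definition is_median :: "real measure \<Rightarrow> real \<Rightarrow> bool" where
  "is_median M m \<longleftrightarrow> measure M {..m} \<ge> 1 / 2 \<and> measure M {m..} \<ge> 1 / 2"

definition lower_end :: "real measure \<Rightarrow> ereal" where
  "lower_end M = Inf {ereal x |x. cdf M x > 0}"

definition upper_end :: "real measure \<Rightarrow> ereal" where
  "upper_end M = Sup {ereal x |x. cdf M x < 1}"

text \<open>Meaningful for \<open>x\<close> strictly between \<^term>\<open>lower_end M\<close> and \<^term>\<open>upper_end M\<close>.\<close>

definition T_op :: "real measure \<Rightarrow> ereal \<Rightarrow> (real \<Rightarrow> real) \<Rightarrow> real \<Rightarrow> real" where
  "T_op M k h x =
     indicator {lower_end M<..k} (ereal x) *
       (1 / cdf M x * set_lebesgue_integral M {y. lower_end M < ereal y \<and> y \<le> x} h) +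
     indicator {k<..<upper_end M} (ereal x) *
       (1 / (1 - cdf M x) * set_lebesgue_integral M {y. x < y \<and> ereal y < upper_end M} h)"

definition enlargement :: "real set \<Rightarrow> real \<Rightarrow> real set" where
  "enlargement A r = {x. \<exists>a\<in>A. \<bar>x - a\<bar> < r}"

definition boundary_measure :: "real measure \<Rightarrow> real set \<Rightarrow> ennreal" where
  "boundary_measure M A =
     Liminf (at_right 0) (\<lambda>r. ennreal ((measure M (enlargement A r) - measure M A) / r))"

definition isoperimetric :: "real measure \<Rightarrow> ennreal \<Rightarrow> bool" where
  "isoperimetric M c \<longleftrightarrow>
     (\<forall>A\<in>sets M. c * ennreal (min (measure M A) (1 - measure M A)) \<le> boundary_measure M A)"

definition Is_const :: "real measure \<Rightarrow> ennreal" where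
  "Is_const M = Sup {c. isoperimetric M c}"

text \<open>The supremum is attained, so \<^term>\<open>Is_const M\<close> is the largest admissible constant.
  Its reciprocal is taken in \<^typ>\<open>ennreal\<close>, so that it is \<open>\<infinity>\<close> when the constant is \<open>0\<close>.\<close>

lemma isoperimetric_Is_const: "isoperimetric M (Is_const M)"
  unfolding isoperimetric_def Is_const_def
  by (auto simp: SUP_mult_right_ennreal[of "\<lambda>x. x", simplified] isoperimetric_def intro!: SUP_least)

end

theory Submission
  imports Defs
begin

text \<open>Let \<open>F\<close> be the distribution function and \<open>h\<^sub>0\<close> the centered \<open>h\<close>. Writing \<open>g x - g m\<close> as the
  integral of \<open>g'\<close> from \<open>m\<close> to \<open>x\<close> and exchanging integrals, \<open>Cov(g, h)\<close> becomes the Lebesgue integral of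
  \<open>\<plusminus> g' \<sqdot> min F (1 - F) \<sqdot> T\<^sub>m h\<^sub>0\<close>; at the median the minimum switches from \<open>F\<close> to \<open>1 - F\<close> exactly as
  \<open>T\<^sub>m\<close> switches its formula. Testing the isoperimetric inequality on half-lines gives
  \<open>Is \<sqdot> min F (1 - F) \<le> f\<close> almost everywhere, and Hoelder's inequality yields the first bound. The
  exchange is legitimate, and the second bound follows from the first, because \<open>T\<^sub>m\<close> has norm at most
  \<open>p\<close> on \<open>L\<^sub>q\<close>: this is Hardy's inequality once \<open>F\<close> transports the measure to the uniform one.

  The fundamental theorem of calculus for absolutely continuous \<open>g\<close> is obtained by writing \<open>g\<close> as the
  difference of two monotone absolutely continuous functions (its variation \<open>V\<close> and \<open>V - g\<close>), whose
  Stieltjes measures have Radon-Nikodym densities, and by differentiating the integrals of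
  these densities.\<close>

section \<open>Absolutely continuous functions as integrals\<close>

text \<open>The first bound contains the signed average \<open>T_m h_0\<close>, but Fubini's theorem
  needs absolute integrability, and absolute values inside the integral produce
  \<open>T_m |h_0|\<close>, which the right-hand side of that bound does not control. Hence Hardy's
  inequality is needed already for the first bound. Its constant \<open>p = q / (q - 1)\<close> is
  the norm on L_q(0, 1) of the operator that averages a function over the interval from 0 to s.
  Absolute continuity is only local. The variation is therefore built for \<open>g\<close> frozen
  outside a window, and the resulting densities depend on the window; they fit together because each
  is almost everywhere the derivative of \<open>g\<close>. The Borel function
  \<open>quotient_limit g\<close> stands for that derivative in the double integral, since the
  values of \<open>deriv g\<close> on the exceptional null set are unspecified.\<close>

text \<open>Families are indexed because clamping the intervals to a window may identify
  several of them, all degenerate.\<close>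

definition interval_family :: "'i set \<Rightarrow> ('i \<Rightarrow> real) \<Rightarrow> ('i \<Rightarrow> real) \<Rightarrow> bool" where
  "interval_family I l r \<longleftrightarrow>
     finite I \<and> (\<forall>i\<in>I. l i \<le> r i) \<and> disjoint_family_on (\<lambda>i. {l i<..<r i}) I"

text \<open>One delta serves the whole line, so later arguments carry no window bounds.
  \<open>abs_cont\<close> functions reach this form by being frozen outside a window.\<close>

definition uniformly_abs_cont :: "(real \<Rightarrow> real) \<Rightarrow> bool" where
  "uniformly_abs_cont g \<longleftrightarrow>
     (\<forall>\<epsilon>>0. \<exists>\<delta>>0. \<forall>D :: (real \<times> real) set. interval_family D fst snd \<longrightarrow>
        (\<Sum>d\<in>D. snd d - fst d) < \<delta> \<longrightarrow> (\<Sum>d\<in>D. \<bar>g (snd d) - g (fst d)\<bar>) < \<epsilon>)"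

definition clamp_to :: "real \<Rightarrow> real \<Rightarrow> real \<Rightarrow> real" where
  "clamp_to x y t = max x (min t y)"

section \<open>Finite families of disjoint intervals\<close>

lemma interval_family_image:
  assumes "interval_family I l r"
  shows "interval_family ((\<lambda>i. (l i, r i)) ` I) fst snd"
proof -
  have "{fst a<..<snd a} \<inter> {fst b<..<snd b} = {}"
    if ab: "a \<in> (\<lambda>i. (l i, r i)) ` I" "b \<in> (\<lambda>i. (l i, r i)) ` I" "a \<noteq> b" for a b
  proof -
    obtain i j where ij: "a = (l i, r i)" "b = (l j, r j)" "i \<in> I" "j \<in> I"
      using ab(1,2) by blast
    moreover have "i \<noteq> j" using ij(1,2) ab(3) by auto
    ultimately have "a = (l i, r i)" "b = (l j, r j)" "i \<in> I" "j \<in> I" "i \<noteq> j"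
      by auto
    with assms show ?thesis
      by (simp add: interval_family_def disjoint_family_on_def)
  qed
  then show ?thesis
    using assms by (simp add: interval_family_def disjoint_family_on_def)
qed

text \<open>Reindexing by endpoints may fail to be injective, but two indices with equal endpoints
  have an open interval disjoint from itself, hence empty; \<phi> sends such a degenerate interval
  to 0.\<close>

lemma sum_interval_family_image:
  fixes \<phi> :: "real \<times> real \<Rightarrow> real"
  assumes "interval_family I l r" and "\<And>x. \<phi> (x, x) = 0"
  shows "sum \<phi> ((\<lambda>i. (l i, r i)) ` I) = (\<Sum>i\<in>I. \<phi> (l i, r i))"
proof -
  have fin: "finite I" and le: "\<And>i. i \<in> I \<Longrightarrow> l i \<le> r i"
    and dj: "\<And>i j. i \<in> I \<Longrightarrow> j \<in> I \<Longrightarrow> i \<noteq> j \<Longrightarrow> {l i<..<r i} \<inter> {l j<..<r j} = {}"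
    using assms(1) by (auto simp: interval_family_def disjoint_family_on_def)
  have "sum \<phi> ((\<lambda>i. (l i, r i)) ` I) = sum (\<phi> \<circ> (\<lambda>i. (l i, r i))) I"
  proof (rule sum.reindex_nontrivial[OF fin])
    fix i j assume ij: "i \<in> I" "j \<in> I" "i \<noteq> j" "(l i, r i) = (l j, r j)"
    then have "{l i<..<r i} = {}"
      using dj[of i j] by simp
    then have "l i = r i"
      using le[OF ij(1)] by (metis antisym_conv1 dense greaterThanLessThan_iff empty_iff)
    then show "\<phi> (l i, r i) = 0"
      by (simp add: assms(2))
  qed
  then show ?thesis by (simp add: o_def)
qed

text \<open>A definition cannot quantify over index types, so \<open>uniformly_abs_cont\<close>
  speaks of sets of pairs. This passes to families over an arbitrary index type, which each use
  fixes.\<close>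

lemma uniformly_abs_contD:
  assumes "uniformly_abs_cont g" "0 < \<epsilon>"
  obtains \<delta> where "0 < \<delta>"
    "\<And>I l r. interval_family I l r \<Longrightarrow> (\<Sum>i\<in>I. r i - l i) < \<delta> \<Longrightarrow>
       (\<Sum>i\<in>I. \<bar>g (r i) - g (l i)\<bar>) < \<epsilon>"
proof -
  obtain \<delta> where \<delta>: "0 < \<delta>" and *: "\<And>D :: (real \<times> real) set. interval_family D fst snd \<Longrightarrow>
      (\<Sum>d\<in>D. snd d - fst d) < \<delta> \<Longrightarrow> (\<Sum>d\<in>D. \<bar>g (snd d) - g (fst d)\<bar>) < \<epsilon>"
    using assms(1)[unfolded uniformly_abs_cont_def, rule_format, OF assms(2)] by blast
  show ?thesis
  proof (rule that[OF \<delta>])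
    fix I :: "'a set" and l r assume fam: "interval_family I l r" and small: "(\<Sum>i\<in>I. r i - l i) < \<delta>"
    show "(\<Sum>i\<in>I. \<bar>g (r i) - g (l i)\<bar>) < \<epsilon>"
      using *[OF interval_family_image[OF fam]] small
        sum_interval_family_image[OF fam, of "\<lambda>d. snd d - fst d"]
        sum_interval_family_image[OF fam, of "\<lambda>d. \<bar>g (snd d) - g (fst d)\<bar>"]
      by simp
  qed
qed

lemma interval_family_clamp:
  assumes "interval_family I l r"
  shows "interval_family I (\<lambda>i. clamp_to x y (l i)) (\<lambda>i. clamp_to x y (r i))"
proof -
  have sub: "{clamp_to x y a<..<clamp_to x y b} \<subseteq> {a<..<b}" for a b
    by (auto simp: clamp_to_def)
  show ?thesis
    using assms unfolding interval_family_def disjoint_family_on_def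
  proof (intro conjI ballI impI; elim conjE)
    fix i assume "i \<in> I" "\<forall>i\<in>I. l i \<le> r i"
    then have "l i \<le> r i" by auto
    then show "clamp_to x y (l i) \<le> clamp_to x y (r i)"
      by (auto simp: clamp_to_def)
  next
    fix i j assume "i \<in> I" "j \<in> I" "i \<noteq> j"
      "\<forall>m\<in>I. \<forall>n\<in>I. m \<noteq> n \<longrightarrow> {l m<..<r m} \<inter> {l n<..<r n} = {}"
    then have "{l i<..<r i} \<inter> {l j<..<r j} = {}" by blast
    then show "{clamp_to x y (l i)<..<clamp_to x y (r i)} \<inter> {clamp_to x y (l j)<..<clamp_to x y (r j)} = {}"
      using sub[of "l i" "r i"] sub[of "l j" "r j"] by blast
  qed
qed

lemma interval_family_min:
  assumes "interval_family I l r"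
  shows "interval_family I (\<lambda>i. min (l i) x) (\<lambda>i. min (r i) x)"
proof -
  have sub: "{min a x<..<min b x} \<subseteq> {a<..<b}" for a b
    by (auto simp: min_def)
  show ?thesis
    using assms unfolding interval_family_def disjoint_family_on_def
  proof (intro conjI ballI impI; elim conjE)
    fix i assume "i \<in> I" "\<forall>i\<in>I. l i \<le> r i"
    then have "l i \<le> r i" by auto
    then show "min (l i) x \<le> min (r i) x"
      by auto
  next
    fix i j assume "i \<in> I" "j \<in> I" "i \<noteq> j"
      "\<forall>m\<in>I. \<forall>n\<in>I. m \<noteq> n \<longrightarrow> {l m<..<r m} \<inter> {l n<..<r n} = {}"
    then have "{l i<..<r i} \<inter> {l j<..<r j} = {}" by blast
    then show "{min (l i) x<..<min (r i) x} \<inter> {min (l j) x<..<min (r j) x} = {}"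
      using sub[of "l i" "r i"] sub[of "l j" "r j"] by blast
  qed
qed

lemma interval_family_length_le:
  assumes "interval_family I l r" and "\<And>i. i \<in> I \<Longrightarrow> {l i<..<r i} \<subseteq> S" and "S \<in> sets lborel"
  shows "ennreal (\<Sum>i\<in>I. r i - l i) \<le> emeasure lborel S"
proof -
  have fin: "finite I" and le: "\<And>i. i \<in> I \<Longrightarrow> l i \<le> r i"
    and dj: "disjoint_family_on (\<lambda>i. {l i<..<r i}) I"
    using assms(1) by (auto simp: interval_family_def)
  have "ennreal (\<Sum>i\<in>I. r i - l i) = (\<Sum>i\<in>I. emeasure lborel {l i<..<r i})"
    using le by (subst sum_ennreal[symmetric]) (auto intro!: sum.cong)
  also have "\<dots> = emeasure lborel (\<Union>i\<in>I. {l i<..<r i})"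
    by (rule sum_emeasure) (use fin dj in auto)
  also have "\<dots> \<le> emeasure lborel S"
    using assms by (intro emeasure_mono) auto
  finally show ?thesis .
qed

lemma interval_family_clamp_length_le:
  assumes "interval_family I l r" "x \<le> y"
  shows "(\<Sum>i\<in>I. clamp_to x y (r i) - clamp_to x y (l i)) \<le> y - x"
proof -
  have "ennreal (\<Sum>i\<in>I. clamp_to x y (r i) - clamp_to x y (l i)) \<le> emeasure lborel {x<..<y}"
    by (rule interval_family_length_le[OF interval_family_clamp[OF assms(1)]])
       (use assms(2) in \<open>auto simp: clamp_to_def\<close>)
  then show ?thesis using assms(2)
    by (simp add: ennreal_le_iff)
qed

text \<open>Collects subdivisions made separately inside the intervals of a family. Tagging each
  piece with its parent \<open>j\<close> keeps equal pairs from distinct parents apart.\<close>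

lemma interval_family_Sigma:
  assumes J: "interval_family J a b"
    and D: "\<And>j. j \<in> J \<Longrightarrow> interval_family (D j) (l j) (r j)"
    and sub: "\<And>j i. j \<in> J \<Longrightarrow> i \<in> D j \<Longrightarrow> {l j i<..<r j i} \<subseteq> {a j<..<b j}"
  shows "interval_family (Sigma J D) (\<lambda>(j, i). l j i) (\<lambda>(j, i). r j i)"
  unfolding interval_family_def
proof (intro conjI)
  show "finite (Sigma J D)" using J D by (auto simp: interval_family_def)
  show "\<forall>d\<in>Sigma J D. (case d of (j, i) \<Rightarrow> l j i) \<le> (case d of (j, i) \<Rightarrow> r j i)"
    using D by (auto simp: interval_family_def)
  show "disjoint_family_on (\<lambda>d. {case d of (j, i) \<Rightarrow> l j i<..<case d of (j, i) \<Rightarrow> r j i}) (Sigma J D)"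
    unfolding disjoint_family_on_def
  proof (intro ballI impI)
    fix d d' assume d: "d \<in> Sigma J D" "d' \<in> Sigma J D" "d \<noteq> d'"
    obtain j i j' i' where dd: "d = (j, i)" "d' = (j', i')" by fastforce
    with d have *: "j \<in> J" "i \<in> D j" "j' \<in> J" "i' \<in> D j'" "(j, i) \<noteq> (j', i')" by auto
    have "{l j i<..<r j i} \<inter> {l j' i'<..<r j' i'} = {}"
    proof (cases "j = j'")
      case True
      with * D[of j] show ?thesis by (auto simp: interval_family_def disjoint_family_on_def)
    next
      case False
      with * J have "{a j<..<b j} \<inter> {a j'<..<b j'} = {}"
        by (auto simp: interval_family_def disjoint_family_on_def)
      with sub[of j i] sub[of j' i'] * show ?thesis by blast
    qed
    then show "{case d of (j, i) \<Rightarrow> l j i<..<case d of (j, i) \<Rightarrow> r j i} \<inter>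
        {case d' of (j, i) \<Rightarrow> l j i<..<case d' of (j, i) \<Rightarrow> r j i} = {}"
      by (simp add: dd)
  qed
qed

lemma uniformly_abs_cont_diff:
  assumes "uniformly_abs_cont g" "uniformly_abs_cont k"
  shows "uniformly_abs_cont (\<lambda>x. g x - k x)"
  unfolding uniformly_abs_cont_def
proof (intro allI impI)
  fix \<epsilon> :: real assume "0 < \<epsilon>"
  then have e2: "0 < \<epsilon> / 2" by simp
  obtain \<delta>1 where 1: "0 < \<delta>1" "\<And>D :: (real \<times> real) set. interval_family D fst snd \<Longrightarrow>
      (\<Sum>d\<in>D. snd d - fst d) < \<delta>1 \<Longrightarrow> (\<Sum>d\<in>D. \<bar>g (snd d) - g (fst d)\<bar>) < \<epsilon> / 2"
    by (rule uniformly_abs_contD[OF assms(1) e2, where 'a = "real \<times> real"]) blast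
  obtain \<delta>2 where 2: "0 < \<delta>2" "\<And>D :: (real \<times> real) set. interval_family D fst snd \<Longrightarrow>
      (\<Sum>d\<in>D. snd d - fst d) < \<delta>2 \<Longrightarrow> (\<Sum>d\<in>D. \<bar>k (snd d) - k (fst d)\<bar>) < \<epsilon> / 2"
    by (rule uniformly_abs_contD[OF assms(2) e2, where 'a = "real \<times> real"]) blast
  show "\<exists>\<delta>>0. \<forall>D. interval_family D fst snd \<longrightarrow> (\<Sum>d\<in>D. snd d - fst d) < \<delta> \<longrightarrow>
          (\<Sum>d\<in>D. \<bar>g (snd d) - k (snd d) - (g (fst d) - k (fst d))\<bar>) < \<epsilon>"
  proof (intro exI[of _ "min \<delta>1 \<delta>2"] conjI allI impI)
    fix D :: "(real \<times> real) set"
    assume D: "interval_family D fst snd" "(\<Sum>d\<in>D. snd d - fst d) < min \<delta>1 \<delta>2"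
    have "(\<Sum>d\<in>D. \<bar>g (snd d) - k (snd d) - (g (fst d) - k (fst d))\<bar>)
        \<le> (\<Sum>d\<in>D. \<bar>g (snd d) - g (fst d)\<bar> + \<bar>k (snd d) - k (fst d)\<bar>)"
      by (rule sum_mono) linarith
    then show "(\<Sum>d\<in>D. \<bar>g (snd d) - k (snd d) - (g (fst d) - k (fst d))\<bar>) < \<epsilon>"
      using 1(2)[OF D(1)] 2(2)[OF D(1)] D(2) by (simp add: sum.distrib)
  qed (use 1 2 in auto)
qed

lemma uniformly_abs_cont_imp_continuous:
  assumes "uniformly_abs_cont g"
  shows "continuous_on UNIV g"
  unfolding continuous_on_iff
proof (intro ballI allI impI)
  fix x e :: real assume "0 < e"
  then obtain \<delta> where \<delta>: "0 < \<delta>" "\<And>D :: (real \<times> real) set. interval_family D fst snd \<Longrightarrow>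
      (\<Sum>d\<in>D. snd d - fst d) < \<delta> \<Longrightarrow> (\<Sum>d\<in>D. \<bar>g (snd d) - g (fst d)\<bar>) < e"
    by (rule uniformly_abs_contD[OF assms, where 'a = "real \<times> real"]) blast
  have "dist (g y) (g x) < e" if "dist y x < \<delta>" for y
  proof (cases "x \<le> y")
    case True
    have "interval_family {(x, y)} fst snd"
      using True by (simp add: interval_family_def disjoint_family_on_def)
    from \<delta>(2)[OF this] that show ?thesis by (simp add: dist_real_def)
  next
    case False
    then have "interval_family {(y, x)} fst snd"
      by (simp add: interval_family_def disjoint_family_on_def)
    from \<delta>(2)[OF this] that show ?thesis by (simp add: dist_real_def abs_minus_commute)
  qed
  then show "\<exists>d>0. \<forall>x'\<in>UNIV. dist x' x < d \<longrightarrow> dist (g x') (g x) < e"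
    using \<delta>(1) by blast
qed

text \<open>Clamping is monotone and lengthens no interval, so a short family on the line becomes a
  short family inside the window, where the modulus of \<open>g\<close> applies.\<close>

lemma abs_cont_clamp:
  assumes "abs_cont g" "c \<le> d"
  shows "uniformly_abs_cont (\<lambda>x. g (clamp_to c d x))"
  unfolding uniformly_abs_cont_def
proof (intro allI impI)
  fix \<epsilon> :: real assume "0 < \<epsilon>"
  then obtain \<delta> where \<delta>: "0 < \<delta>" and *: "\<And>D :: (real \<times> real) set. finite D \<Longrightarrow>
       (\<forall>(u, v)\<in>D. c \<le> u \<and> u \<le> v \<and> v \<le> d) \<Longrightarrow> disjoint_family_on (\<lambda>(u, v). {u<..<v}) D \<Longrightarrow>
       (\<Sum>(u, v)\<in>D. v - u) < \<delta> \<Longrightarrow> (\<Sum>(u, v)\<in>D. \<bar>g v - g u\<bar>) < \<epsilon>"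
    using assms(1)[unfolded abs_cont_def abs_cont_on_def, rule_format, OF assms(2)] by blast
  show "\<exists>\<delta>>0. \<forall>D. interval_family D fst snd \<longrightarrow> (\<Sum>d\<in>D. snd d - fst d) < \<delta> \<longrightarrow>
          (\<Sum>x\<in>D. \<bar>g (clamp_to c d (snd x)) - g (clamp_to c d (fst x))\<bar>) < \<epsilon>"
  proof (intro exI[of _ \<delta>] conjI allI impI \<delta>)
    fix D :: "(real \<times> real) set"
    assume D: "interval_family D fst snd" "(\<Sum>d\<in>D. snd d - fst d) < \<delta>"
    let ?c = "\<lambda>x. (clamp_to c d (fst x), clamp_to c d (snd x))"
    note fam = interval_family_clamp[OF D(1), of c d]
    have im: "interval_family (?c ` D) fst snd"
      using interval_family_image[OF fam] .
    have "(\<Sum>x\<in>?c ` D. snd x - fst x) = (\<Sum>x\<in>D. clamp_to c d (snd x) - clamp_to c d (fst x))"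
      by (subst sum_interval_family_image[OF fam]) auto
    also have "\<dots> \<le> (\<Sum>x\<in>D. snd x - fst x)"
      using D(1) by (intro sum_mono) (auto simp: interval_family_def clamp_to_def min_def max_def)
    finally have len: "(\<Sum>(u, v)\<in>?c ` D. v - u) < \<delta>"
      using D(2) by (simp add: case_prod_unfold)
    have "(\<Sum>(u, v)\<in>?c ` D. \<bar>g v - g u\<bar>) < \<epsilon>"
    proof (rule *)
      show "finite (?c ` D)" "disjoint_family_on (\<lambda>(u, v). {u<..<v}) (?c ` D)"
        using im by (auto simp: interval_family_def case_prod_unfold)
      show "\<forall>(u, v)\<in>?c ` D. c \<le> u \<and> u \<le> v \<and> v \<le> d"
        using fam assms(2) by (auto simp: interval_family_def clamp_to_def)
    qed fact
    moreover have "(\<Sum>(u, v)\<in>?c ` D. \<bar>g v - g u\<bar>)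
        = (\<Sum>x\<in>D. \<bar>g (clamp_to c d (snd x)) - g (clamp_to c d (fst x))\<bar>)"
      by (subst sum_interval_family_image[OF fam]) (auto simp: case_prod_unfold)
    ultimately show "(\<Sum>x\<in>D. \<bar>g (clamp_to c d (snd x)) - g (clamp_to c d (fst x))\<bar>) < \<epsilon>"
      by simp
  qed
qed

section \<open>The variation function\<close>

definition oscillation_sum :: "(real \<Rightarrow> real) \<Rightarrow> (real \<times> real) set \<Rightarrow> real" where
  "oscillation_sum g D = (\<Sum>d\<in>D. \<bar>g (snd d) - g (fst d)\<bar>)"

definition families_upto :: "real \<Rightarrow> (real \<times> real) set set" where
  "families_upto x = {D. interval_family D fst snd \<and> (\<forall>d\<in>D. snd d \<le> x)}"

text \<open>Total variation on the half-line that ends at \<open>x\<close>. It is finite for the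
  functions of interest, which are constant on either side of a window.\<close>

definition variation :: "(real \<Rightarrow> real) \<Rightarrow> real \<Rightarrow> real" where
  "variation g x = (SUP D\<in>families_upto x. oscillation_sum g D)"

text \<open>Cut the window into \<open>N\<close> pieces shorter than the delta that belongs to
  epsilon = 1. Every family then contributes at most 1 on each piece, hence at most \<open>N\<close>
  in total.\<close>

lemma clamp_oscillation_bounded:
  assumes "uniformly_abs_cont g" "c \<le> d"
  shows "\<exists>K. \<forall>D. interval_family D fst snd \<longrightarrow> oscillation_sum (\<lambda>x. g (clamp_to c d x)) D \<le> K"
proof -
  obtain \<delta> where \<delta>: "0 < \<delta>" "\<And>D l r. interval_family (D :: (real \<times> real) set) l r \<Longrightarrow>
      (\<Sum>d\<in>D. r d - l d) < \<delta> \<Longrightarrow> (\<Sum>d\<in>D. \<bar>g (r d) - g (l d)\<bar>) < 1"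
    by (rule uniformly_abs_contD[OF assms(1) zero_less_one, where 'a = "real \<times> real"]) blast
  obtain N :: nat where N: "(d - c) / \<delta> < real N" using reals_Archimedean2 by blast
  have N0: "0 < N" using N assms(2) \<delta>(1)
    by (metis divide_nonneg_pos diff_ge_0_iff_ge gr0I not_le of_nat_0)
  define s where "s = (d - c) / N"
  define t where "t k = c + real k * s" for k
  have tN: "t N = d" "t 0 = c" using N0 by (simp_all add: t_def s_def)
  have tmono: "t k \<le> t (Suc k)" and tc: "c \<le> t k" for k
    using assms(2) by (simp_all add: t_def s_def mult_right_mono divide_right_mono)
  have tstep: "t (Suc k) - t k < \<delta>" for k
  proof -
    have "t (Suc k) - t k = (d - c) / N" by (simp add: t_def s_def[symmetric] distrib_right)
    also have "\<dots> < \<delta>" using N N0 \<delta>(1) by (simp add: field_simps)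
    finally show ?thesis .
  qed
  \<comment> \<open>For \<open>v\<close> left of \<open>t k\<close> both sides are 0; right of
    \<open>t (Suc k)\<close> both are the full increment over the piece. Summed over
    \<open>k\<close>, the left-hand sides telescope.\<close>
  have step: "g (clamp_to c (t (Suc k)) v) - g (clamp_to c (t k) v) = g (clamp_to (t k) (t (Suc k)) v) - g (t k)" for k v
    using tmono[of k] tc[of k] by (cases "v \<le> t k"; cases "v \<le> t (Suc k)") (simp_all add: clamp_to_def)
  have tel: "g (clamp_to c d v) - g c = (\<Sum>k<N. g (clamp_to (t k) (t (Suc k)) v) - g (t k))" for v
    unfolding step[symmetric] by (subst sum_lessThan_telescope) (simp add: tN clamp_to_def)
  have diff: "\<bar>g (clamp_to c d v) - g (clamp_to c d u)\<bar>
      \<le> (\<Sum>k<N. \<bar>g (clamp_to (t k) (t (Suc k)) v) - g (clamp_to (t k) (t (Suc k)) u)\<bar>)" for u v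
  proof -
    have "g (clamp_to c d v) - g (clamp_to c d u)
        = (\<Sum>k<N. g (clamp_to (t k) (t (Suc k)) v) - g (clamp_to (t k) (t (Suc k)) u))"
      using tel[of v] tel[of u] by (simp add: sum_subtractf)
    then show ?thesis by (simp add: sum_abs)
  qed
  have "oscillation_sum (\<lambda>x. g (clamp_to c d x)) D \<le> real N" if D: "interval_family D fst snd" for D
  proof -
    have "oscillation_sum (\<lambda>x. g (clamp_to c d x)) D
        \<le> (\<Sum>x\<in>D. \<Sum>k<N. \<bar>g (clamp_to (t k) (t (Suc k)) (snd x)) - g (clamp_to (t k) (t (Suc k)) (fst x))\<bar>)"
      unfolding oscillation_sum_def by (intro sum_mono diff)
    also have "\<dots> = (\<Sum>k<N. \<Sum>x\<in>D. \<bar>g (clamp_to (t k) (t (Suc k)) (snd x)) - g (clamp_to (t k) (t (Suc k)) (fst x))\<bar>)"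
      by (rule sum.swap)
    also have "\<dots> \<le> (\<Sum>k<N. 1)"
    proof (rule sum_mono)
      fix k
      show "(\<Sum>x\<in>D. \<bar>g (clamp_to (t k) (t (Suc k)) (snd x)) - g (clamp_to (t k) (t (Suc k)) (fst x))\<bar>) \<le> 1"
        by (intro less_imp_le \<delta>(2) interval_family_clamp[OF D]
            le_less_trans[OF interval_family_clamp_length_le[OF D tmono] tstep])
    qed
    finally show ?thesis by simp
  qed
  then show ?thesis by blast
qed

text \<open>Without such a bound the real supremum in \<open>variation\<close> would be meaningless.
  For a frozen function \<open>K\<close> comes from
  \<open>clamp_oscillation_bounded\<close>.\<close>

context
  fixes g :: "real \<Rightarrow> real" and K :: real
  assumes bounded: "\<And>D. interval_family D fst snd \<Longrightarrow> oscillation_sum g D \<le> K"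
begin

lemma bdd_above_oscillation: "bdd_above (oscillation_sum g ` families_upto x)"
  using bounded by (auto simp: families_upto_def intro!: bdd_aboveI2)

lemma families_upto_nonempty: "families_upto x \<noteq> {}"
proof -
  have "{} \<in> families_upto x"
    by (auto simp: families_upto_def interval_family_def disjoint_family_on_def)
  then show ?thesis by blast
qed

lemma variation_upper: "D \<in> families_upto x \<Longrightarrow> oscillation_sum g D \<le> variation g x"
  unfolding variation_def by (rule cSUP_upper[OF _ bdd_above_oscillation])

text \<open>Adjoin the interval from \<open>x\<close> to \<open>y\<close> to a family that ends by
  \<open>x\<close>. The absolute value makes both the variation and its difference with
  \<open>g\<close> monotone.\<close>

lemma variation_ge:
  assumes "x \<le> y"
  shows "variation g x + \<bar>g y - g x\<bar> \<le> variation g y"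
proof -
  have "oscillation_sum g D \<le> variation g y - \<bar>g y - g x\<bar>" if D: "D \<in> families_upto x" for D
  proof (cases "x = y")
    case True
    with variation_upper D show ?thesis by simp
  next
    case False
    then have xy: "x < y" using assms by simp
    have fin: "finite D" using D by (simp add: families_upto_def interval_family_def)
    have notin: "(x, y) \<notin> D" using D xy by (auto simp: families_upto_def)
    have "insert (x, y) D \<in> families_upto y"
      using D xy unfolding families_upto_def interval_family_def disjoint_family_on_def
      by (fastforce simp: disjoint_iff)
    from variation_upper[OF this] show ?thesis
      using fin notin by (simp add: oscillation_sum_def)
  qed
  then have "variation g x \<le> variation g y - \<bar>g y - g x\<bar>"
    unfolding variation_def[of g x] by (intro cSUP_least families_upto_nonempty)
  then show ?thesis by simp
qed

text \<open>Cut the intervals of a nearly optimal family for \<open>y\<close> at \<open>x\<close>.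
  The left parts cost at most \<open>variation g x\<close>, so the parts in \<open>{x..y}\<close>
  carry the rest up to \<open>e\<close>.\<close>

lemma variation_diff_le:
  assumes "x \<le> y" "0 < e"
  obtains D where "interval_family D fst snd" "\<And>d. d \<in> D \<Longrightarrow> x \<le> fst d \<and> snd d \<le> y"
    "variation g y - variation g x \<le> oscillation_sum g D + e"
proof -
  have "variation g y - e < variation g y" using assms(2) by simp
  then obtain D where D: "D \<in> families_upto y" and less: "variation g y - e < oscillation_sum g D"
    unfolding variation_def[of g y]
    using less_cSUP_iff[OF families_upto_nonempty bdd_above_oscillation] by blast
  have fam: "interval_family D fst snd" and le: "\<And>d. d \<in> D \<Longrightarrow> snd d \<le> y" "\<And>d. d \<in> D \<Longrightarrow> fst d \<le> snd d"
    using D by (auto simp: families_upto_def interval_family_def)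
  let ?m = "\<lambda>d. (min (fst d) x, min (snd d) x)" and ?c = "\<lambda>d. (clamp_to x y (fst d), clamp_to x y (snd d))"
  note m = interval_family_min[OF fam, of x] and c = interval_family_clamp[OF fam, of x y]
  have "?m ` D \<in> families_upto x"
    using interval_family_image[OF m] by (auto simp: families_upto_def)
  from variation_upper[OF this] have 1: "(\<Sum>d\<in>D. \<bar>g (min (snd d) x) - g (min (fst d) x)\<bar>) \<le> variation g x"
    unfolding oscillation_sum_def by (subst (asm) sum_interval_family_image[OF m]) auto
  have 2: "oscillation_sum g (?c ` D) = (\<Sum>d\<in>D. \<bar>g (clamp_to x y (snd d)) - g (clamp_to x y (fst d))\<bar>)"
    unfolding oscillation_sum_def by (subst sum_interval_family_image[OF c]) auto
  have split: "g t = g (min t x) + g (clamp_to x y t) - g x" if "t \<le> y" for t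
    using that assms(1) by (cases "t \<le> x") (auto simp: clamp_to_def)
  have "oscillation_sum g D \<le> (\<Sum>d\<in>D. \<bar>g (min (snd d) x) - g (min (fst d) x)\<bar>
      + \<bar>g (clamp_to x y (snd d)) - g (clamp_to x y (fst d))\<bar>)"
    unfolding oscillation_sum_def
  proof (rule sum_mono)
    fix d assume d: "d \<in> D"
    show "\<bar>g (snd d) - g (fst d)\<bar> \<le> \<bar>g (min (snd d) x) - g (min (fst d) x)\<bar>
        + \<bar>g (clamp_to x y (snd d)) - g (clamp_to x y (fst d))\<bar>"
      using split[OF le(1)[OF d]] split[OF order_trans[OF le(2)[OF d] le(1)[OF d]]] by linarith
  qed
  then have "variation g y - variation g x \<le> oscillation_sum g (?c ` D) + e"
    using less 1 2 by (simp add: sum.distrib)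
  moreover have "\<And>d. d \<in> ?c ` D \<Longrightarrow> x \<le> fst d \<and> snd d \<le> y"
    using assms(1) by (auto simp: clamp_to_def)
  ultimately show ?thesis using that[OF interval_family_image[OF c]] by blast
qed

text \<open>Inside each interval of a short family choose a subfamily that attains the variation up
  to \<open>e\<close>. All these subfamilies together are still shorter than \<delta>, so the
  modulus of \<open>g\<close> bounds their joint oscillation.\<close>

lemma uniformly_abs_cont_variation:
  assumes "uniformly_abs_cont g"
  shows "uniformly_abs_cont (variation g)"
  unfolding uniformly_abs_cont_def
proof (intro allI impI)
  fix \<epsilon> :: real assume \<epsilon>: "0 < \<epsilon>"
  then have "0 < \<epsilon> / 2" by simp
  obtain \<delta> where \<delta>: "0 < \<delta>" "\<And>I l r. interval_family (I :: ((real \<times> real) \<times> (real \<times> real)) set) l r \<Longrightarrow>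
      (\<Sum>i\<in>I. r i - l i) < \<delta> \<Longrightarrow> (\<Sum>i\<in>I. \<bar>g (r i) - g (l i)\<bar>) < \<epsilon> / 2"
    by (rule uniformly_abs_contD[OF assms \<open>0 < \<epsilon> / 2\<close>, where 'a = "(real \<times> real) \<times> (real \<times> real)"]) blast
  show "\<exists>\<delta>>0. \<forall>J. interval_family J fst snd \<longrightarrow> (\<Sum>d\<in>J. snd d - fst d) < \<delta> \<longrightarrow>
      (\<Sum>d\<in>J. \<bar>variation g (snd d) - variation g (fst d)\<bar>) < \<epsilon>"
  proof (intro exI[of _ \<delta>] conjI allI impI \<delta>(1))
    fix J :: "(real \<times> real) set"
    assume J: "interval_family J fst snd" and small: "(\<Sum>d\<in>J. snd d - fst d) < \<delta>"
    have fin: "finite J" and le: "\<And>j. j \<in> J \<Longrightarrow> fst j \<le> snd j"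
      using J by (auto simp: interval_family_def)
    \<comment> \<open>The \<open>card J\<close> errors sum to at most half of \<epsilon>; the added
      1 avoids division by 0 for an empty family.\<close>
    define e where "e = \<epsilon> / (2 * (card J + 1))"
    have e: "0 < e" using \<epsilon> by (simp add: e_def)
    have "\<exists>D. interval_family D fst snd \<and> (\<forall>d\<in>D. fst j \<le> fst d \<and> snd d \<le> snd j) \<and>
        variation g (snd j) - variation g (fst j) \<le> oscillation_sum g D + e" if "j \<in> J" for j
      using variation_diff_le[OF le[OF that] e] by metis
    then obtain D where D: "\<And>j. j \<in> J \<Longrightarrow> interval_family (D j) fst snd"
      "\<And>j d. j \<in> J \<Longrightarrow> d \<in> D j \<Longrightarrow> fst j \<le> fst d \<and> snd d \<le> snd j"
      "\<And>j. j \<in> J \<Longrightarrow> variation g (snd j) - variation g (fst j) \<le> oscillation_sum g (D j) + e"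
      by metis
    have finD: "\<forall>j\<in>J. finite (D j)" using D(1) by (simp add: interval_family_def)
    have fam: "interval_family (Sigma J D) (\<lambda>(j, i). fst i) (\<lambda>(j, i). snd i)"
      by (rule interval_family_Sigma[OF J D(1)]) (use D(2) in fastforce)+
    have "(\<Sum>i\<in>Sigma J D. (case i of (j, i) \<Rightarrow> snd i) - (case i of (j, i) \<Rightarrow> fst i))
        = (\<Sum>j\<in>J. \<Sum>i\<in>D j. snd i - fst i)"
      by (subst sum.Sigma[OF fin finD]) (simp add: case_prod_unfold)
    also have "\<dots> \<le> (\<Sum>j\<in>J. snd j - fst j)"
    proof (rule sum_mono)
      fix j assume j: "j \<in> J"
      have "ennreal (\<Sum>i\<in>D j. snd i - fst i) \<le> emeasure lborel {fst j<..<snd j}"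
        by (rule interval_family_length_le[OF D(1)[OF j]]) (use D(2)[OF j] in fastforce)+
      then show "(\<Sum>i\<in>D j. snd i - fst i) \<le> snd j - fst j"
        using le[OF j] by (simp add: ennreal_le_iff)
    qed
    finally have "(\<Sum>i\<in>Sigma J D. \<bar>g (case i of (j, i) \<Rightarrow> snd i) - g (case i of (j, i) \<Rightarrow> fst i)\<bar>) < \<epsilon> / 2"
      using small by (intro \<delta>(2)[OF fam]) simp
    moreover have "(\<Sum>i\<in>Sigma J D. \<bar>g (case i of (j, i) \<Rightarrow> snd i) - g (case i of (j, i) \<Rightarrow> fst i)\<bar>)
        = (\<Sum>j\<in>J. oscillation_sum g (D j))"
      unfolding oscillation_sum_def by (subst sum.Sigma[OF fin finD]) (simp add: case_prod_unfold)
    ultimately have sum: "(\<Sum>j\<in>J. oscillation_sum g (D j)) < \<epsilon> / 2" by simp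
    have "(\<Sum>j\<in>J. \<bar>variation g (snd j) - variation g (fst j)\<bar>) \<le> (\<Sum>j\<in>J. oscillation_sum g (D j) + e)"
    proof (rule sum_mono)
      fix j assume j: "j \<in> J"
      have "variation g (fst j) \<le> variation g (snd j)"
        using variation_ge[OF le[OF j]] by linarith
      then show "\<bar>variation g (snd j) - variation g (fst j)\<bar> \<le> oscillation_sum g (D j) + e"
        using D(3)[OF j] by simp
    qed
    also have "\<dots> = (\<Sum>j\<in>J. oscillation_sum g (D j)) + card J * e"
      by (simp add: sum.distrib)
    also have "card J * e \<le> \<epsilon> / 2"
      using \<epsilon> by (simp add: e_def field_simps)
    finally show "(\<Sum>d\<in>J. \<bar>variation g (snd d) - variation g (fst d)\<bar>) < \<epsilon>"
      using sum by linarith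
  qed
qed

end

section \<open>Stieltjes measures and their densities\<close>

text \<open>Enclose \<open>N\<close> in an open set of Lebesgue measure below \<delta> and cover it
  there by countably many nonoverlapping closed intervals. Finitely many of them form a family
  shorter than \<delta>, so their Stieltjes measure is at most \<epsilon>; continuity from below
  passes to all of them.\<close>

lemma uniformly_abs_cont_null_bounded:
  fixes M :: "real \<Rightarrow> real"
  assumes uac: "uniformly_abs_cont M" and mono: "\<And>x y. x \<le> y \<Longrightarrow> M x \<le> M y"
    and N: "N \<in> sets borel" "emeasure lborel N = 0" "N \<subseteq> {a..b}" "a < b" and \<epsilon>: "0 < \<epsilon>"
  shows "emeasure (interval_measure M) N \<le> ennreal \<epsilon>"
proof -
  have cont: "continuous_on UNIV M"
    by (rule uniformly_abs_cont_imp_continuous[OF uac])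
  obtain \<delta> where \<delta>: "0 < \<delta>" "\<And>I l r. interval_family (I :: real set set) l r \<Longrightarrow>
      (\<Sum>i\<in>I. r i - l i) < \<delta> \<Longrightarrow> (\<Sum>i\<in>I. \<bar>M (r i) - M (l i)\<bar>) < \<epsilon>"
    by (rule uniformly_abs_contD[OF uac \<epsilon>, where 'a = "real set"]) blast
  obtain U where U: "open U" "N \<subseteq> U" "emeasure lborel (U - N) < \<delta>"
    using outer_regular_lborel[OF N(1) \<delta>(1)] by blast
  have "emeasure lborel U \<le> emeasure lborel (U - N) + emeasure lborel N"
    using N U(1) by (subst plus_emeasure) (auto intro!: emeasure_mono)
  then have U\<delta>: "emeasure lborel U < \<delta>"
    using U(3) N(2) by simp
  \<comment> \<open>Each covering interval lies in \<open>G x\<close> for one of its points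
    \<open>x\<close> in \<open>N\<close>, hence in \<open>U\<close>; the value off \<open>U\<close>
    only serves to make \<open>G\<close> a gauge.\<close>
  define G where "G x = (if x \<in> U then U else UNIV)" for x
  have gauge: "gauge G"
    using U(1) by (auto simp: G_def gauge_def)
  obtain \<D> where \<D>: "countable \<D>" "\<Union>\<D> \<subseteq> cbox a b"
    "\<And>K. K \<in> \<D> \<Longrightarrow> interior K \<noteq> {} \<and> (\<exists>c d. K = cbox c d)"
    "pairwise (\<lambda>A B. interior A \<inter> interior B = {}) \<D>"
    "\<And>K. K \<in> \<D> \<Longrightarrow> \<exists>x \<in> N \<inter> K. K \<subseteq> G x"
    "N \<subseteq> \<Union>\<D>"
  proof (rule covering_lemma[OF _ _ gauge])
    show "N \<subseteq> cbox a b" "box a b \<noteq> {}" using N(3,4) by auto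
  qed (rule that)
  have KU: "K \<subseteq> U" if "K \<in> \<D>" for K
    using \<D>(5)[OF that] U(2) by (auto simp: G_def split: if_splits)
  have KI: "K = {Inf K..Sup K} \<and> Inf K < Sup K" if KD: "K \<in> \<D>" for K
  proof -
    obtain c d where K: "K = {c..d}" using \<D>(3)[OF KD] by (auto simp: cbox_interval)
    with \<D>(3)[OF KD] have "c < d" by (auto simp: interior_atLeastAtMost_real not_less)
    with K show ?thesis by simp
  qed
  have fin: "emeasure (interval_measure M) (\<Union>F) \<le> \<epsilon>" if F: "finite F" "F \<subseteq> \<D>" for F
  proof -
    have KIF: "K = {Inf K..Sup K}" "Inf K < Sup K" if "K \<in> F" for K
      using KI F(2) that by auto
    have fam: "interval_family F Inf Sup"
      unfolding interval_family_def disjoint_family_on_def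
    proof (intro conjI ballI impI F(1))
      show "Inf K \<le> Sup K" if "K \<in> F" for K using KIF(2)[OF that] by simp
      fix K L assume KL: "K \<in> F" "L \<in> F" "K \<noteq> L"
      have "interior K = {Inf K<..<Sup K}" "interior L = {Inf L<..<Sup L}"
        using KIF(1)[OF KL(1)] KIF(1)[OF KL(2)] interior_atLeastAtMost_real by metis+
      then show "{Inf K<..<Sup K} \<inter> {Inf L<..<Sup L} = {}"
        using \<D>(4) KL F(2) unfolding pairwise_def by (metis subsetD)
    qed
    have "ennreal (\<Sum>K\<in>F. Sup K - Inf K) \<le> emeasure lborel U"
    proof (rule interval_family_length_le[OF fam])
      fix K assume "K \<in> F"
      then have "{Inf K<..<Sup K} \<subseteq> K" using KIF(1)[of K] greaterThanLessThan_subseteq_atLeastAtMost_iff by blast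
      then show "{Inf K<..<Sup K} \<subseteq> U" using KU \<open>K \<in> F\<close> F(2) by blast
    qed (use U in auto)
    then have "ennreal (\<Sum>K\<in>F. Sup K - Inf K) < ennreal \<delta>" using U\<delta> by (rule le_less_trans)
    then have "(\<Sum>K\<in>F. Sup K - Inf K) < \<delta>"
      using \<delta>(1) by (simp add: ennreal_less_iff sum_nonneg KIF(2) less_imp_le)
    then have less: "(\<Sum>K\<in>F. \<bar>M (Sup K) - M (Inf K)\<bar>) < \<epsilon>" by (rule \<delta>(2)[OF fam])
    have meas: "K \<in> sets (interval_measure M)" if "K \<in> F" for K
      using KIF(1)[OF that] by (metis atLeastAtMost_borel sets_interval_measure)
    have "emeasure (interval_measure M) (\<Union>K\<in>F. K) \<le> (\<Sum>K\<in>F. emeasure (interval_measure M) K)"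
      by (rule emeasure_subadditive_finite) (use F(1) meas in auto)
    also have "\<dots> = (\<Sum>K\<in>F. ennreal \<bar>M (Sup K) - M (Inf K)\<bar>)"
    proof (rule sum.cong[OF refl])
      fix K assume K: "K \<in> F"
      have "emeasure (interval_measure M) {Inf K..Sup K} = M (Sup K) - M (Inf K)"
        by (rule emeasure_interval_measure_Icc[OF _ mono cont]) (use KIF(2)[OF K] in auto)
      then show "emeasure (interval_measure M) K = ennreal \<bar>M (Sup K) - M (Inf K)\<bar>"
        using KIF[OF K] mono[of "Inf K" "Sup K"] by simp
    qed
    also have "\<dots> = ennreal (\<Sum>K\<in>F. \<bar>M (Sup K) - M (Inf K)\<bar>)" by simp
    also have "\<dots> \<le> \<epsilon>" using less by (intro ennreal_leI) simp
    finally show ?thesis by simp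
  qed
  show ?thesis
  proof (cases "\<D> = {}")
    case True with \<D>(6) show ?thesis by simp
  next
    case False
    define E where "E n = (\<Union>i\<le>n. from_nat_into \<D> i)" for n :: nat
    have memD: "from_nat_into \<D> i \<in> \<D>" for i using False by (rule from_nat_into)
    have Emeas: "range E \<subseteq> sets (interval_measure M)"
    proof -
      have "from_nat_into \<D> i \<in> sets borel" for i
        using KI[OF memD[of i]] by (metis atLeastAtMost_borel)
      then show ?thesis by (auto simp: E_def)
    qed
    have "incseq E" unfolding E_def incseq_def by (intro allI impI UN_mono) auto
    have "N \<subseteq> (\<Union>n. E n)"
    proof
      fix x assume "x \<in> N"
      then obtain K where "K \<in> \<D>" "x \<in> K" using \<D>(6) by blast
      then obtain i where "from_nat_into \<D> i = K" using from_nat_into_surj[OF \<D>(1)] by blast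
      then show "x \<in> (\<Union>n. E n)" using \<open>x \<in> K\<close> by (auto simp: E_def)
    qed
    then have "emeasure (interval_measure M) N \<le> emeasure (interval_measure M) (\<Union>n. E n)"
      using Emeas by (intro emeasure_mono) auto
    also have "\<dots> = (SUP n. emeasure (interval_measure M) (E n))"
      by (rule SUP_emeasure_incseq[symmetric, OF Emeas \<open>incseq E\<close>])
    also have "\<dots> \<le> \<epsilon>"
    proof (rule SUP_least)
      fix n
      have "E n = \<Union>(from_nat_into \<D> ` {..n})" by (simp add: E_def)
      then show "emeasure (interval_measure M) (E n) \<le> \<epsilon>"
        using fin[of "from_nat_into \<D> ` {..n}"] memD by auto
    qed
    finally show ?thesis .
  qed
qed

lemma uniformly_abs_cont_absolutely_continuous:
  fixes M :: "real \<Rightarrow> real"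
  assumes uac: "uniformly_abs_cont M" and mono: "\<And>x y. x \<le> y \<Longrightarrow> M x \<le> M y"
  shows "absolutely_continuous lborel (interval_measure M)"
  unfolding absolutely_continuous_def
proof
  fix N :: "real set" assume N: "N \<in> null_sets lborel"
  have "emeasure (interval_measure M) (N \<inter> {-real n..real n}) = 0" for n
  proof -
    have "emeasure (interval_measure M) (N \<inter> {-real n..real n}) \<le> 0 + ennreal \<epsilon>" if "0 < \<epsilon>" for \<epsilon>
    proof -
      have "emeasure lborel (N \<inter> {-real n..real n}) \<le> emeasure lborel N"
        using N by (intro emeasure_mono) auto
      then show ?thesis
        \<comment> \<open>The window is widened by 1 so that its ends differ also for
          \<open>n = 0\<close>.\<close>
        using uniformly_abs_cont_null_bounded[OF uac mono, of "N \<inter> {-real n..real n}" "-real n - 1" "real n + 1" \<epsilon>] N that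
        by (force simp: null_sets_def)
    qed
    then show ?thesis
      using ennreal_le_epsilon[of 0 "emeasure (interval_measure M) (N \<inter> {-real n..real n})"] by simp
  qed
  then have "(\<Union>n. N \<inter> {-real n..real n}) \<in> null_sets (interval_measure M)"
    using N by (intro null_sets_UN') (auto simp: null_sets_def)
  moreover have "(\<Union>n. N \<inter> {-real n..real n}) = N"
  proof -
    have "\<exists>n::nat. x \<in> {-real n..real n}" for x :: real
    proof -
      obtain n :: nat where "\<bar>x\<bar> \<le> real n" using real_arch_simple by blast
      then have "x \<in> {-real n..real n}" by (auto simp: abs_le_iff)
      then show ?thesis ..
    qed
    then show ?thesis by blast
  qed
  ultimately show "N \<in> null_sets (interval_measure M)" by simp
qed

text \<open>The Radon-Nikodym density of the Stieltjes measure takes values in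
  \<open>ennreal\<close>. Its integrals over bounded intervals are increments of \<open>M\<close>,
  so it is finite almost everywhere and can be replaced by a real function.\<close>

lemma mono_uniformly_abs_cont_density:
  fixes M :: "real \<Rightarrow> real"
  assumes uac: "uniformly_abs_cont M" and mono: "\<And>x y. x \<le> y \<Longrightarrow> M x \<le> M y"
  obtains \<gamma> :: "real \<Rightarrow> real" where "\<gamma> \<in> borel_measurable borel"
    "\<And>x y. x \<le> y \<Longrightarrow> set_integrable lborel {x..y} \<gamma> \<and> (LINT t:{x..y}|lborel. \<gamma> t) = M y - M x"
proof -
  have cont: "continuous_on UNIV M"
    by (rule uniformly_abs_cont_imp_continuous[OF uac])
  obtain \<phi> where \<phi>: "\<phi> \<in> borel_measurable lborel" "density lborel \<phi> = interval_measure M"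
    using sigma_finite_measure.Radon_Nikodym[OF sigma_finite_lborel uniformly_abs_cont_absolutely_continuous[OF uac mono]] by auto
  have \<phi>int: "(\<integral>\<^sup>+t. \<phi> t * indicator {x..y} t \<partial>lborel) = ennreal (M y - M x)" if "x \<le> y" for x y
  proof -
    have "(\<integral>\<^sup>+t. \<phi> t * indicator {x..y} t \<partial>lborel) = emeasure (interval_measure M) {x..y}"
      using \<phi> by (subst \<phi>(2)[symmetric], subst emeasure_density) auto
    then show ?thesis
      using emeasure_interval_measure_Icc[OF that mono cont] by simp
  qed
  have "AE t in lborel. \<phi> t \<noteq> \<infinity>"
  proof -
    have "AE t in lborel. \<phi> t * indicator {- real n..real n} t \<noteq> \<infinity>" for n :: nat
      using \<phi>int[of "-real n" "real n"] \<phi>(1) by (intro nn_integral_PInf_AE) auto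
    then have "AE t in lborel. \<forall>n::nat. \<phi> t * indicator {- real n..real n} t \<noteq> \<infinity>"
      by (simp add: AE_all_countable)
    then show ?thesis
    proof eventually_elim
      case (elim t)
      obtain n :: nat where "\<bar>t\<bar> \<le> real n" using real_arch_simple by blast
      then have "t \<in> {- real n..real n}" by (auto simp: abs_le_iff)
      with elim[rule_format, of n] show ?case by simp
    qed
  qed
  define \<gamma> where "\<gamma> t = enn2real (\<phi> t)" for t
  have \<gamma>0: "0 \<le> \<gamma> t" for t by (simp add: \<gamma>_def)
  have meas[measurable]: "\<gamma> \<in> borel_measurable borel"
    using \<phi>(1) unfolding \<gamma>_def by measurable
  have "set_integrable lborel {x..y} \<gamma> \<and> (LINT t:{x..y}|lborel. \<gamma> t) = M y - M x" if xy: "x \<le> y" for x y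
  proof -
    have "(\<integral>\<^sup>+t. ennreal (indicator {x..y} t * \<gamma> t) \<partial>lborel) = (\<integral>\<^sup>+t. \<phi> t * indicator {x..y} t \<partial>lborel)"
      using \<open>AE t in lborel. \<phi> t \<noteq> \<infinity>\<close>
      by (intro nn_integral_cong_AE) (auto simp: \<gamma>_def indicator_def less_top)
    then have *: "(\<integral>\<^sup>+t. ennreal (indicator {x..y} t * \<gamma> t) \<partial>lborel) = ennreal (M y - M x)"
      using \<phi>int[OF xy] by simp
    have "integrable lborel (\<lambda>t. indicator {x..y} t * \<gamma> t)"
      by (rule integrableI_nonneg) (use * \<gamma>0 in auto)
    moreover have "(LINT t|lborel. indicator {x..y} t * \<gamma> t) = M y - M x"
      using mono[OF xy] * \<gamma>0 by (subst integral_eq_nn_integral) auto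
    ultimately show ?thesis
      by (simp add: set_integrable_def set_lebesgue_integral_def)
  qed
  with meas show ?thesis by (rule that)
qed

text \<open>The density obtained here depends on the window, because the variation does;
  \<open>abs_cont_fundamental\<close> removes this dependence.\<close>

lemma abs_cont_primitive:
  assumes "abs_cont g" "c \<le> d"
  obtains \<gamma> :: "real \<Rightarrow> real" where "\<gamma> \<in> borel_measurable borel"
    "\<And>x y. c \<le> x \<Longrightarrow> x \<le> y \<Longrightarrow> y \<le> d \<Longrightarrow> (LINT t:{x..y}|lborel. \<gamma> t) = g y - g x"
    "\<And>x y. x \<le> y \<Longrightarrow> set_integrable lborel {x..y} \<gamma>"
proof -
  define k where "k x = g (clamp_to c d x)" for x
  \<comment> \<open>Freezing twice is freezing once, so the oscillation bound, stated for a clamped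
    function, holds for \<open>k\<close> itself.\<close>
  have kk: "k (clamp_to c d x) = k x" for x
    using assms(2) by (simp add: k_def clamp_to_def)
  have uac: "uniformly_abs_cont k"
    unfolding k_def by (rule abs_cont_clamp[OF assms])
  obtain K where K: "\<And>D. interval_family D fst snd \<Longrightarrow> oscillation_sum k D \<le> K"
    using clamp_oscillation_bounded[OF uac assms(2)] by (auto simp: kk)
  define V where "V = variation k"
  have V: "V x + \<bar>k y - k x\<bar> \<le> V y" if "x \<le> y" for x y
    unfolding V_def by (rule variation_ge[OF K that])
  have uacV: "uniformly_abs_cont V"
    unfolding V_def by (rule uniformly_abs_cont_variation[OF K uac])
  obtain \<gamma>1 where 1: "\<gamma>1 \<in> borel_measurable borel"
    "\<And>x y. x \<le> y \<Longrightarrow> set_integrable lborel {x..y} \<gamma>1 \<and> (LINT t:{x..y}|lborel. \<gamma>1 t) = V y - V x"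
    by (rule mono_uniformly_abs_cont_density[OF uacV]) (use V in fastforce)+
  obtain \<gamma>2 where 2: "\<gamma>2 \<in> borel_measurable borel"
    "\<And>x y. x \<le> y \<Longrightarrow> set_integrable lborel {x..y} \<gamma>2 \<and> (LINT t:{x..y}|lborel. \<gamma>2 t) = V y - k y - (V x - k x)"
    by (rule mono_uniformly_abs_cont_density[OF uniformly_abs_cont_diff[OF uacV uac]]) (use V in fastforce)+
  show ?thesis
  proof
    show "(\<lambda>t. \<gamma>1 t - \<gamma>2 t) \<in> borel_measurable borel" using 1 2 by simp
    show "set_integrable lborel {x..y} (\<lambda>t. \<gamma>1 t - \<gamma>2 t)" if "x \<le> y" for x y
      using 1(2)[OF that] 2(2)[OF that] by (simp add: set_integral_diff)
    show "(LINT t:{x..y}|lborel. \<gamma>1 t - \<gamma>2 t) = g y - g x" if "c \<le> x" "x \<le> y" "y \<le> d" for x y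
      using 1(2)[OF that(2)] 2(2)[OF that(2)] that by (simp add: set_integral_diff k_def clamp_to_def)
  qed
qed

section \<open>Almost everywhere differentiation\<close>

lemma set_integrable_Icc_imp_integrable_on:
  fixes \<phi> :: "real \<Rightarrow> real"
  assumes "\<And>a b. set_integrable lborel {a..b} \<phi>"
  shows "\<phi> integrable_on cbox a b"
  using set_borel_integral_eq_integral(1)[OF assms[of a b]] by (simp add: cbox_interval)

text \<open>The differentiation theorem for cubes, in dimension one: the cube with corner
  \<open>x\<close> and side \<open>h\<close> is \<open>{x..x + h}\<close>. Its negligible
  exceptional set passes to \<open>lborel\<close> through the completion.\<close>

lemma lebesgue_differentiation_right:
  fixes \<phi> :: "real \<Rightarrow> real"
  assumes int: "\<And>a b. set_integrable lborel {a..b} \<phi>"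
  shows "AE x in lborel. \<forall>e>0. \<exists>d>0. \<forall>h. 0 < h \<and> h < d \<longrightarrow> \<bar>(LINT t:{x..x + h}|lborel. \<phi> t) / h - \<phi> x\<bar> < e"
proof -
  obtain N where N: "negligible N" "\<And>x e. \<lbrakk>x \<notin> N; 0 < e\<rbrakk> \<Longrightarrow> \<exists>d>0. \<forall>h. 0 < h \<and> h < d \<longrightarrow>
      norm (integral (cbox x (x + h *\<^sub>R One)) \<phi> /\<^sub>R h ^ DIM(real) - \<phi> x) < e"
    using integrable_ccontinuous_explicit[of \<phi>, OF set_integrable_Icc_imp_integrable_on[OF int]] by blast
  have "AE x in lebesgue. x \<notin> N"
    using N(1) by (intro AE_not_in) (simp add: negligible_iff_null_sets)
  then have "AE x in lborel. x \<notin> N" by (simp add: AE_completion_iff)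
  then show ?thesis
  proof eventually_elim
    case (elim x)
    show ?case
    proof (intro allI impI)
      fix e :: real assume "0 < e"
      from N(2)[OF elim this] obtain d where d: "d > 0" "\<And>h. 0 < h \<Longrightarrow> h < d \<Longrightarrow>
          norm (integral (cbox x (x + h *\<^sub>R One)) \<phi> /\<^sub>R h ^ DIM(real) - \<phi> x) < e" by blast
      show "\<exists>d>0. \<forall>h. 0 < h \<and> h < d \<longrightarrow> \<bar>(LINT t:{x..x + h}|lborel. \<phi> t) / h - \<phi> x\<bar> < e"
      proof (intro exI[of _ d] conjI allI impI d(1))
        fix h assume "0 < h \<and> h < d"
        with d(2)[of h] show "\<bar>(LINT t:{x..x + h}|lborel. \<phi> t) / h - \<phi> x\<bar> < e"
          by (simp add: set_borel_integral_eq_integral(2)[OF int] cbox_interval divide_inverse mult.commute)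
      qed
    qed
  qed
qed

text \<open>Averages to the left of \<open>x\<close> are averages to the right of \<open>- x\<close>
  for the reflected function. \<open>G\<close> is quantified inside, so the exceptional set depends
  on \<phi> alone, and \<open>G\<close> has to be a primitive only near \<open>x\<close>.\<close>

lemma lebesgue_differentiation:
  fixes \<phi> :: "real \<Rightarrow> real"
  assumes int: "\<And>a b. set_integrable lborel {a..b} \<phi>"
  shows "AE x in lborel. \<forall>G e. 0 < e \<longrightarrow>
    (\<forall>u v. x - e < u \<longrightarrow> u \<le> v \<longrightarrow> v < x + e \<longrightarrow> G v - G u = (LINT t:{u..v}|lborel. \<phi> t)) \<longrightarrow>
    (G has_real_derivative \<phi> x) (at x)"
proof -
  have int': "set_integrable lborel {a..b} (\<lambda>x. \<phi> (- x))" for a b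
  proof -
    have eq: "(\<lambda>x. indicat_real {- b..- a} (0 + - 1 * x) *\<^sub>R \<phi> (0 + - 1 * x)) = (\<lambda>x. indicat_real {a..b} x *\<^sub>R \<phi> (- x))"
      by (auto simp: indicator_def)
    show ?thesis
      using lborel_integrable_real_affine[OF int[of "-b" "-a", unfolded set_integrable_def], of "-1" 0]
      unfolding eq by (simp add: set_integrable_def)
  qed
  have refl: "(LINT t:{- x..- x + h}|lborel. \<phi> (- t)) = (LINT t:{x - h..x}|lborel. \<phi> t)" for x h
  proof -
    have "{t. - t \<in> {x - h..x}} = {- x..- x + h}" by auto
    then show ?thesis by (subst (2) set_integral_reflect) simp
  qed
  have right: "AE x in lborel. \<forall>e>0. \<exists>d>0. \<forall>h. 0 < h \<and> h < d \<longrightarrow> \<bar>(LINT t:{x..x + h}|lborel. \<phi> t) / h - \<phi> x\<bar> < e"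
    by (rule lebesgue_differentiation_right[OF int])
  have left: "AE x in lborel. \<forall>e>0. \<exists>d>0. \<forall>h. 0 < h \<and> h < d \<longrightarrow> \<bar>(LINT t:{x - h..x}|lborel. \<phi> t) / h - \<phi> x\<bar> < e"
  proof -
    obtain N where N: "N \<in> null_sets lborel" and sub: "{x \<in> space lborel. \<not> (\<forall>e>0. \<exists>d>0. \<forall>h. 0 < h \<and> h < d \<longrightarrow>
        \<bar>(LINT t:{x..x + h}|lborel. \<phi> (- t)) / h - \<phi> (- x)\<bar> < e)} \<subseteq> N"
      using lebesgue_differentiation_right[OF int'] unfolding eventually_ae_filter by blast
    \<comment> \<open>The reflected exceptional set is null as well; the point is written as the
      affine map that the rule expects.\<close>
    have "AE x in lborel. 0 + - 1 * x \<notin> N"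
      by (rule AE_borel_affine) (use N AE_not_in[OF N] in \<open>auto simp: null_sets_def\<close>)
    then show ?thesis
    proof eventually_elim
      case (elim x)
      have "\<forall>e>0. \<exists>d>0. \<forall>h. 0 < h \<and> h < d \<longrightarrow> \<bar>(LINT t:{y..y + h}|lborel. \<phi> (- t)) / h - \<phi> (- y)\<bar> < e"
        if "y \<notin> N" for y
        using sub that unfolding space_lborel space_borel by blast
      from this[of "- x"] elim have "\<forall>e>0. \<exists>d>0. \<forall>h. 0 < h \<and> h < d \<longrightarrow> \<bar>(LINT t:{- x..- x + h}|lborel. \<phi> (- t)) / h - \<phi> (- (- x))\<bar> < e"
        by simp
      then show ?case unfolding refl by simp
    qed
  qed
  show ?thesis
    using right left
  proof eventually_elim
    case (elim x)
    show ?case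
    proof (intro allI impI)
      fix G :: "real \<Rightarrow> real" and e :: real
      assume e: "0 < e" and G: "\<forall>u v. x - e < u \<longrightarrow> u \<le> v \<longrightarrow> v < x + e \<longrightarrow> G v - G u = (LINT t:{u..v}|lborel. \<phi> t)"
      show "(G has_real_derivative \<phi> x) (at x)"
        unfolding DERIV_def LIM_def
      proof (intro allI impI)
        fix r :: real assume r: "0 < r"
        obtain d1 where d1: "0 < d1" "\<And>h. 0 < h \<Longrightarrow> h < d1 \<Longrightarrow> \<bar>(LINT t:{x..x + h}|lborel. \<phi> t) / h - \<phi> x\<bar> < r"
          using elim(1) r by blast
        obtain d2 where d2: "0 < d2" "\<And>h. 0 < h \<Longrightarrow> h < d2 \<Longrightarrow> \<bar>(LINT t:{x - h..x}|lborel. \<phi> t) / h - \<phi> x\<bar> < r"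
          using elim(2) r by blast
        show "\<exists>s>0. \<forall>h. h \<noteq> 0 \<and> dist h 0 < s \<longrightarrow> dist ((G (x + h) - G x) / h) (\<phi> x) < r"
        proof (intro exI[of _ "min e (min d1 d2)"] conjI allI impI)
          fix h :: real assume h: "h \<noteq> 0 \<and> dist h 0 < min e (min d1 d2)"
          show "dist ((G (x + h) - G x) / h) (\<phi> x) < r"
          proof (cases "0 < h")
            case True
            with h have "G (x + h) - G x = (LINT t:{x..x + h}|lborel. \<phi> t)"
              using e by (intro G[rule_format]) auto
            with d1(2)[of h] True h show ?thesis by (simp add: dist_real_def)
          next
            case False
            define k where "k = - h"
            have k: "0 < k" "k < e" "k < d2" "h = - k" using False h by (auto simp: k_def)
            then have "G x - G (x - k) = (LINT t:{x - k..x}|lborel. \<phi> t)"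
              using e by (intro G[rule_format]) auto
            moreover have "(G (x + h) - G x) / h = (G x - G (x - k)) / k"
              using k by (simp add: field_simps)
            ultimately show ?thesis using d2(2)[of k] k by (simp add: dist_real_def)
          qed
        qed (use e d1 d2 in auto)
      qed
    qed
  qed
qed

text \<open>A Borel version of the derivative; where the limit does not exist, the value is
  unspecified.\<close>

definition quotient_limit :: "(real \<Rightarrow> real) \<Rightarrow> real \<Rightarrow> real" where
  "quotient_limit g x = lim (\<lambda>n. (g (x + 1 / real (Suc n)) - g x) / (1 / real (Suc n)))"

lemma quotient_limit_eq:
  assumes "(g has_real_derivative D) (at x)"
  shows "quotient_limit g x = D"
proof -
  have "((\<lambda>h. (g (x + h) - g x) / h) \<longlongrightarrow> D) (at 0)"
    using assms by (simp add: DERIV_def)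
  moreover have "filterlim (\<lambda>n. 1 / real (Suc n)) (at 0) sequentially"
    unfolding filterlim_at using LIMSEQ_Suc[OF lim_1_over_n] by (auto intro!: always_eventually)
  ultimately have "(\<lambda>n. (g (x + 1 / real (Suc n)) - g x) / (1 / real (Suc n))) \<longlonglongrightarrow> D"
    by (rule filterlim_compose)
  then show ?thesis unfolding quotient_limit_def by (rule limI)
qed

lemma borel_measurable_quotient_limit:
  assumes "continuous_on UNIV g"
  shows "quotient_limit g \<in> borel_measurable borel"
proof -
  have [measurable]: "g \<in> borel_measurable borel"
    using assms by (rule borel_measurable_continuous_onI)
  show ?thesis unfolding quotient_limit_def[abs_def] by measurable
qed

lemma abs_cont_imp_continuous:
  assumes "abs_cont g"
  shows "continuous_on UNIV g"
proof -
  have "isCont g x" for x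
  proof -
    have "isCont (\<lambda>y. g (clamp_to (x - 1) (x + 1) y)) x"
      using uniformly_abs_cont_imp_continuous[OF abs_cont_clamp[OF assms, of "x - 1" "x + 1"]]
      by (simp add: continuous_on_eq_continuous_at)
    moreover have "\<forall>\<^sub>F y in nhds x. y \<in> {x - 1<..<x + 1}"
      by (rule eventually_nhds_in_open) auto
    then have "\<forall>\<^sub>F y in nhds x. g (clamp_to (x - 1) (x + 1) y) = g y"
      by eventually_elim (auto simp: clamp_to_def)
    ultimately show ?thesis using isCont_cong by fast
  qed
  then show ?thesis by (simp add: continuous_at_imp_continuous_on)
qed

text \<open>Each window density is almost everywhere the derivative inside its window, hence equal
  there to \<open>quotient_limit g\<close>, in which no window occurs. Countably many windows
  exhaust the line.\<close>

theorem abs_cont_fundamental: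
  assumes "abs_cont g"
  shows "AE x in lborel. (g has_real_derivative quotient_limit g x) (at x)"
    and "x \<le> y \<Longrightarrow> set_integrable lborel {x..y} (quotient_limit g)"
    and "x \<le> y \<Longrightarrow> (LINT t:{x..y}|lborel. quotient_limit g t) = g y - g x"
proof -
  have local: "\<exists>\<gamma>. (\<forall>x y. c \<le> x \<longrightarrow> x \<le> y \<longrightarrow> y \<le> d \<longrightarrow> (LINT t:{x..y}|lborel. \<gamma> t) = g y - g x)
      \<and> (\<forall>x y. set_integrable lborel {x..y} \<gamma>)
      \<and> (AE x in lborel. c < x \<longrightarrow> x < d \<longrightarrow> (g has_real_derivative \<gamma> x) (at x))" if cd: "c \<le> d" for c d
  proof -
    obtain \<gamma> :: "real \<Rightarrow> real" where \<gamma>: "\<gamma> \<in> borel_measurable borel"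
      "\<And>x y. c \<le> x \<Longrightarrow> x \<le> y \<Longrightarrow> y \<le> d \<Longrightarrow> (LINT t:{x..y}|lborel. \<gamma> t) = g y - g x"
      "\<And>x y. x \<le> y \<Longrightarrow> set_integrable lborel {x..y} \<gamma>"
      by (rule abs_cont_primitive[OF assms cd]) blast
    have int: "set_integrable lborel {x..y} \<gamma>" for x y
      using \<gamma>(3)[of x y] by (cases "x \<le> y") (simp_all add: set_integrable_def)
    have "AE x in lborel. c < x \<longrightarrow> x < d \<longrightarrow> (g has_real_derivative \<gamma> x) (at x)"
      using lebesgue_differentiation[OF int]
    proof eventually_elim
      case (elim x)
      show ?case
      proof (intro impI)
        assume x: "c < x" "x < d"
        show "(g has_real_derivative \<gamma> x) (at x)"
        proof (rule elim[rule_format])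
          show "0 < min (x - c) (d - x)" using x by simp
          fix u v assume "x - min (x - c) (d - x) < u" "u \<le> v" "v < x + min (x - c) (d - x)"
          then have "c \<le> u" "u \<le> v" "v \<le> d" by linarith+
          then show "g v - g u = (LINT t:{u..v}|lborel. \<gamma> t)" by (simp add: \<gamma>(2))
        qed
      qed
    qed
    with \<gamma>(2) int show ?thesis by blast
  qed
  have "AE x in lborel. - real n < x \<longrightarrow> x < real n \<longrightarrow> (g has_real_derivative quotient_limit g x) (at x)" for n
  proof -
    obtain \<gamma> where "AE x in lborel. - real n < x \<longrightarrow> x < real n \<longrightarrow> (g has_real_derivative \<gamma> x) (at x)"
      using local[of "- real n" "real n"] by auto
    then show ?thesis by eventually_elim (auto simp: quotient_limit_eq)
  qed
  then have "AE x in lborel. \<forall>n. - real n < x \<longrightarrow> x < real n \<longrightarrow> (g has_real_derivative quotient_limit g x) (at x)"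
    by (simp add: AE_all_countable)
  then show "AE x in lborel. (g has_real_derivative quotient_limit g x) (at x)"
  proof eventually_elim
    case (elim x)
    obtain n :: nat where "\<bar>x\<bar> < real n" using reals_Archimedean2 by blast
    then have "- real n < x" "x < real n" by auto
    then show ?case using elim by blast
  qed
  have meas[measurable]: "quotient_limit g \<in> borel_measurable borel"
    by (rule borel_measurable_quotient_limit[OF abs_cont_imp_continuous[OF assms]])
  have "set_integrable lborel {x..y} (quotient_limit g) \<and> (LINT t:{x..y}|lborel. quotient_limit g t) = g y - g x"
    if xy: "x \<le> y"
  proof -
    obtain \<gamma> where \<gamma>: "\<And>u v. x \<le> u \<Longrightarrow> u \<le> v \<Longrightarrow> v \<le> y \<Longrightarrow> (LINT t:{u..v}|lborel. \<gamma> t) = g v - g u"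
      "\<And>u v. set_integrable lborel {u..v} \<gamma>"
      "AE t in lborel. x < t \<longrightarrow> t < y \<longrightarrow> (g has_real_derivative \<gamma> t) (at t)"
      using local[OF xy] by blast
    \<comment> \<open>The derivative is identified only in the open window; the two endpoints are
      null.\<close>
    have ae: "AE t in lborel. indicat_real {x..y} t *\<^sub>R \<gamma> t = indicat_real {x..y} t *\<^sub>R quotient_limit g t"
      using \<gamma>(3) AE_lborel_singleton[of x] AE_lborel_singleton[of y]
      by eventually_elim (auto simp: indicator_def quotient_limit_eq)
    have m: "(\<lambda>t. indicat_real {x..y} t *\<^sub>R quotient_limit g t) \<in> borel_measurable lborel"
      by measurable
    have m': "(\<lambda>t. indicat_real {x..y} t *\<^sub>R \<gamma> t) \<in> borel_measurable lborel"
      using \<gamma>(2)[of x y] unfolding set_integrable_def by (rule borel_measurable_integrable)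
    show ?thesis
      using integrable_cong_AE[OF m' m ae] integral_cong_AE[OF m' m ae] \<gamma>(1)[of x y] \<gamma>(2)[of x y] xy
      by (simp add: set_integrable_def set_lebesgue_integral_def)
  qed
  then show "x \<le> y \<Longrightarrow> set_integrable lborel {x..y} (quotient_limit g)"
    "x \<le> y \<Longrightarrow> (LINT t:{x..y}|lborel. quotient_limit g t) = g y - g x" by auto
qed

lemma abs_cont_deriv_AE:
  assumes "abs_cont g"
  shows "AE x in lborel. deriv g x = quotient_limit g x"
  using abs_cont_fundamental(1)[OF assms] by eventually_elim (rule DERIV_imp_deriv)

section \<open>Hoelder and Hardy inequalities\<close>

lemma Lp_norm_ennreal:
  assumes "0 < r"
  shows "Lp_norm M (ennreal r) f = (if (\<integral>\<^sup>+x. ennreal (\<bar>f x\<bar> powr r) \<partial>M) = \<infinity> then \<infinity>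
      else ennreal (enn2real (\<integral>\<^sup>+x. ennreal (\<bar>f x\<bar> powr r) \<partial>M) powr (1 / r)))"
  using assms by (simp add: Lp_norm_def Let_def)

lemma nn_integral_powr_eq_0D:
  fixes u :: "'a \<Rightarrow> real"
  assumes "u \<in> borel_measurable M" "(\<integral>\<^sup>+x. ennreal (\<bar>u x\<bar> powr r) \<partial>M) = 0"
  shows "AE x in M. u x = 0"
proof -
  have [measurable]: "u \<in> borel_measurable M" by fact
  have "AE x in M. ennreal (\<bar>u x\<bar> powr r) = 0"
    using assms(2) by (subst (asm) nn_integral_0_iff_AE) auto
  then show ?thesis by eventually_elim auto
qed

lemma Lp_norm_eq_0D:
  assumes "u \<in> borel_measurable M" "0 < r" "Lp_norm M r u = 0"
  shows "AE x in M. u x = 0"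
proof (cases r)
  case (real r')
  then have r': "0 < r'" using assms(2) by simp
  have "(\<integral>\<^sup>+x. ennreal (\<bar>u x\<bar> powr r') \<partial>M) = 0"
    using assms(3) r' unfolding real(2) Lp_norm_ennreal[OF r']
    by (auto simp: enn2real_eq_0_iff split: if_splits)
  then show ?thesis by (rule nn_integral_powr_eq_0D[OF assms(1)])
next
  case top
  with assms(3) have "esssup M (\<lambda>x. ennreal \<bar>u x\<bar>) = 0"
    by (simp add: Lp_norm_def)
  then show ?thesis
    using esssup_AE[of "\<lambda>x. ennreal \<bar>u x\<bar>" M] by simp
qed

text \<open>Young's inequality for the normalized \<open>\<bar>u x\<bar> / s\<close> and
  \<open>\<bar>v x\<bar> / t\<close>, rescaled by \<open>s * t\<close> and integrated; the weights
  \<open>1 / p\<close> and \<open>1 / q\<close> then sum to 1. Normalizing fails if \<open>a\<close>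
  or \<open>b\<close> is 0, but then one factor vanishes almost everywhere.\<close>

lemma holder_real:
  fixes u v :: "'a \<Rightarrow> real"
  assumes pq: "1 < p" "1 < q" "1 / p + 1 / q = 1"
    and [measurable]: "u \<in> borel_measurable M" "v \<in> borel_measurable M"
    and A: "(\<integral>\<^sup>+x. ennreal (\<bar>u x\<bar> powr p) \<partial>M) = ennreal a" "0 \<le> a"
    and B: "(\<integral>\<^sup>+x. ennreal (\<bar>v x\<bar> powr q) \<partial>M) = ennreal b" "0 \<le> b"
  shows "(\<integral>\<^sup>+x. ennreal \<bar>u x * v x\<bar> \<partial>M) \<le> ennreal (a powr (1 / p) * b powr (1 / q))"
proof (cases "a = 0 \<or> b = 0")
  case True
  then have "AE x in M. u x * v x = 0"
  proof
    assume "a = 0"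
    then have "AE x in M. u x = 0" using A by (intro nn_integral_powr_eq_0D[where r = p]) auto
    then show ?thesis by eventually_elim simp
  next
    assume "b = 0"
    then have "AE x in M. v x = 0" using B by (intro nn_integral_powr_eq_0D[where r = q]) auto
    then show ?thesis by eventually_elim simp
  qed
  then have "(\<integral>\<^sup>+x. ennreal \<bar>u x * v x\<bar> \<partial>M) = (\<integral>\<^sup>+x. 0 \<partial>M)"
    by (intro nn_integral_cong_AE) auto
  then show ?thesis by simp
next
  case False
  then have ab: "0 < a" "0 < b" using A B by auto
  define s t where "s = a powr (1 / p)" and "t = b powr (1 / q)"
  have st: "0 < s" "0 < t" "s powr p = a" "t powr q = b"
    using ab pq by (simp_all add: s_def t_def powr_powr)
  have young: "\<bar>u x * v x\<bar> \<le> s * t / (a * p) * \<bar>u x\<bar> powr p + s * t / (b * q) * \<bar>v x\<bar> powr q" for x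
  proof -
    have "(\<bar>u x\<bar> / s) * (\<bar>v x\<bar> / t) \<le> (\<bar>u x\<bar> / s) powr p / p + (\<bar>v x\<bar> / t) powr q / q"
      using pq st by (intro Youngs_inequality) auto
    also have "\<dots> = \<bar>u x\<bar> powr p / (a * p) + \<bar>v x\<bar> powr q / (b * q)"
      using st by (simp add: powr_divide)
    finally have "(s * t) * ((\<bar>u x\<bar> / s) * (\<bar>v x\<bar> / t)) \<le> (s * t) * (\<bar>u x\<bar> powr p / (a * p) + \<bar>v x\<bar> powr q / (b * q))"
      using st by (intro mult_left_mono) auto
    then show ?thesis using st(1,2) by (simp add: abs_mult distrib_left)
  qed
  have "(\<integral>\<^sup>+x. ennreal \<bar>u x * v x\<bar> \<partial>M)
      \<le> (\<integral>\<^sup>+x. ennreal (s * t / (a * p)) * ennreal (\<bar>u x\<bar> powr p) + ennreal (s * t / (b * q)) * ennreal (\<bar>v x\<bar> powr q) \<partial>M)"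
  proof (rule nn_integral_mono)
    fix x
    show "ennreal \<bar>u x * v x\<bar> \<le> ennreal (s * t / (a * p)) * ennreal (\<bar>u x\<bar> powr p) + ennreal (s * t / (b * q)) * ennreal (\<bar>v x\<bar> powr q)"
      using young[of x] st ab pq by (simp add: ennreal_mult'[symmetric] ennreal_plus[symmetric] del: ennreal_plus)
  qed
  also have "\<dots> = ennreal (s * t / (a * p)) * ennreal a + ennreal (s * t / (b * q)) * ennreal b"
    using A B by (simp add: nn_integral_add nn_integral_cmult)
  also have "\<dots> = ennreal (s * t / (a * p) * a + s * t / (b * q) * b)"
    using st ab pq by (simp add: ennreal_mult'[symmetric] ennreal_plus[symmetric] del: ennreal_plus)
  also have "s * t / (a * p) * a + s * t / (b * q) * b = s * t * (1 / p + 1 / q)"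
    using ab pq(1,2) by (simp add: field_simps)
  finally show ?thesis using pq(3) by (simp add: s_def t_def)
qed

text \<open>An infinite \<open>q\<close> has inverse 0 and so forces \<open>p = 1\<close>. A finite
  \<open>q\<close> is nonzero, as \<open>inverse 0\<close> is infinite, and then both reciprocals
  are positive, hence both below 1.\<close>

lemma ennreal_conjugate_cases:
  fixes p q :: ennreal
  assumes "1 \<le> p" "p < \<infinity>" "inverse p + inverse q = 1"
  obtains "p = 1" "q = \<infinity>"
  | p' q' where "p = ennreal p'" "q = ennreal q'" "1 < p'" "1 < q'" "1 / p' + 1 / q' = 1"
proof -
  obtain p' where p: "p = ennreal p'" "0 \<le> p'" using assms(2) by (cases p) auto
  then have p1: "1 \<le> p'" using assms(1) by simp
  have ip: "inverse p = ennreal (inverse p')"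
    using p p1 by (simp add: inverse_ennreal)
  show thesis
  proof (cases q)
    case top
    then have "ennreal (inverse p') = 1" using assms(3) ip by simp
    then have "p' = 1" by (simp add: ennreal_eq_1)
    then show ?thesis using p top by (intro that(1)) simp_all
  next
    case (real q')
    have "q' \<noteq> 0"
    proof
      assume "q' = 0"
      then have "inverse q = \<infinity>" using real by simp
      then show False using assms(3) by simp
    qed
    then have q0: "0 < q'" using real by simp
    then have "ennreal (inverse p' + inverse q') = 1"
      using assms(3) ip real p1 by (simp add: inverse_ennreal)
    then have eq: "1 / p' + 1 / q' = 1" by (simp add: ennreal_eq_1 inverse_eq_divide)
    have "1 < p'"
    proof (rule ccontr)
      assume "\<not> 1 < p'"
      then have "p' = 1" using p1 by simp
      then show False using eq q0 by simp
    qed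
    moreover have "1 < q'"
    proof -
      have "0 < 1 / p'" using p1 by simp
      then have "1 / q' < 1" using eq by linarith
      then show ?thesis using q0 by simp
    qed
    ultimately show ?thesis using p real eq by (intro that(2))
  qed
qed

lemma Lp_norm_holder:
  fixes u v :: "real \<Rightarrow> real"
  assumes pq: "1 \<le> p" "p < \<infinity>" "inverse p + inverse q = 1"
    and meas[measurable]: "u \<in> borel_measurable M" "v \<in> borel_measurable M"
  shows "(\<integral>\<^sup>+x. ennreal \<bar>u x * v x\<bar> \<partial>M) \<le> Lp_norm M p u * Lp_norm M q v"
  using pq
proof (cases rule: ennreal_conjugate_cases)
  case 1
  have "(\<integral>\<^sup>+x. ennreal \<bar>u x * v x\<bar> \<partial>M) \<le> (\<integral>\<^sup>+x. ennreal \<bar>u x\<bar> * esssup M (\<lambda>x. ennreal \<bar>v x\<bar>) \<partial>M)"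
  proof (rule nn_integral_mono_AE)
    show "AE x in M. ennreal \<bar>u x * v x\<bar> \<le> ennreal \<bar>u x\<bar> * esssup M (\<lambda>x. ennreal \<bar>v x\<bar>)"
      using esssup_AE[of "\<lambda>x. ennreal \<bar>v x\<bar>" M]
      by eventually_elim (simp add: abs_mult ennreal_mult mult_left_mono)
  qed
  also have "\<dots> = (\<integral>\<^sup>+x. ennreal \<bar>u x\<bar> \<partial>M) * esssup M (\<lambda>x. ennreal \<bar>v x\<bar>)"
    by (rule nn_integral_multc) measurable
  also have "\<dots> = Lp_norm M p u * Lp_norm M q v"
    using 1 by (simp add: Lp_norm_def Let_def less_top[symmetric] ennreal_enn2real_if)
  finally show ?thesis .
next
  case (2 p' q')
  let ?A = "\<integral>\<^sup>+x. ennreal (\<bar>u x\<bar> powr p') \<partial>M" and ?B = "\<integral>\<^sup>+x. ennreal (\<bar>v x\<bar> powr q') \<partial>M"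
  have n: "Lp_norm M p u = (if ?A = \<infinity> then \<infinity> else ennreal (enn2real ?A powr (1 / p')))"
    "Lp_norm M q v = (if ?B = \<infinity> then \<infinity> else ennreal (enn2real ?B powr (1 / q')))"
    using 2 by (simp_all add: Lp_norm_ennreal)
  have pos: "0 < p" "0 < q" using 2 by auto
  \<comment> \<open>Vanishing norms come before infinite ones: 0 times infinity is 0, so an infinite
    norm makes the product infinite only if the other norm is nonzero.\<close>
  consider "Lp_norm M p u = 0 \<or> Lp_norm M q v = 0" | "Lp_norm M p u \<noteq> 0" "Lp_norm M q v \<noteq> 0" "?A = \<infinity> \<or> ?B = \<infinity>"
    | "?A \<noteq> \<infinity>" "?B \<noteq> \<infinity>" by blast
  then show ?thesis
  proof cases
    case 1
    then have "AE x in M. u x * v x = 0"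
      using Lp_norm_eq_0D[OF meas(1) pos(1)] Lp_norm_eq_0D[OF meas(2) pos(2)]
      by (auto elim!: eventually_mono)
    then have "(\<integral>\<^sup>+x. ennreal \<bar>u x * v x\<bar> \<partial>M) = (\<integral>\<^sup>+x. 0 \<partial>M)"
      by (intro nn_integral_cong_AE) auto
    then show ?thesis by simp
  next
    case 2
    then have "Lp_norm M p u = \<infinity> \<or> Lp_norm M q v = \<infinity>"
      using n by presburger
    then have "Lp_norm M p u * Lp_norm M q v = \<infinity>"
      using 2(1,2) by (auto simp: ennreal_mult_top ennreal_top_mult)
    then show ?thesis by simp
  next
    case 3
    then obtain a b where "?A = ennreal a" "0 \<le> a" "?B = ennreal b" "0 \<le> b"
      by (cases ?A; cases ?B) auto
    then show ?thesis
      using holder_real[OF 2(3-5) meas, of a b] n by (simp add: ennreal_mult'[symmetric])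
  qed
qed

section \<open>Hardy's inequality\<close>

text \<open>With \<open>r = 1 / p\<close>, this and the next integral are the two halves of Schur's
  test in \<open>hardy_uniform\<close>; each yields a factor \<open>p\<close>.\<close>

lemma nn_integral_powr_lower:
  fixes r s :: real
  assumes "0 \<le> s" "0 < r"
  shows "(\<integral>\<^sup>+u. ennreal (indicator {0..s} u * u powr (r - 1)) \<partial>lborel) = ennreal (s powr r / r)"
proof -
  have "((\<lambda>u. u powr (r - 1)) has_integral (s powr (r - 1 + 1) / (r - 1 + 1))) {0..s}"
    using assms by (intro has_integral_powr_from_0) auto
  then have "((\<lambda>u. u powr (r - 1)) has_integral (s powr r / r)) {0..s}" by simp
  then show ?thesis
    by (intro nn_integral_has_integral_lebesgue[of "{0..s}" "\<lambda>u. u powr (r - 1)"]) auto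
qed

lemma nn_integral_powr_upper:
  fixes r s :: real
  assumes "0 < s" "0 < r"
  shows "(\<integral>\<^sup>+u. ennreal (indicator {s..} u * u powr (- 1 - r)) \<partial>lborel) = ennreal (s powr (- r) / r)"
proof -
  have "(\<integral>\<^sup>+u. ennreal (u powr (- 1 - r)) * indicator {s..} u \<partial>lborel) = ennreal (0 - (- (s powr (- r) / r)))"
  proof (rule nn_integral_FTC_atLeast)
    fix x assume "s \<le> x"
    then have "0 < x" using assms by simp
    then show "((\<lambda>x. - (x powr (- r) / r)) has_real_derivative x powr (- 1 - r)) (at x)"
      using assms by (auto intro!: derivative_eq_intros simp: field_simps powr_diff powr_minus)
  next
    have "((\<lambda>x. - (x powr (- r) / r)) \<longlongrightarrow> - (0 / r)) at_top"
      using assms by (intro tendsto_intros tendsto_neg_powr filterlim_ident) auto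
    then show "((\<lambda>x. - (x powr (- r) / r)) \<longlongrightarrow> 0) at_top" by simp
  qed auto
  moreover have "(\<integral>\<^sup>+u. ennreal (indicator {s..} u * u powr (- 1 - r)) \<partial>lborel)
      = (\<integral>\<^sup>+u. ennreal (u powr (- 1 - r)) * indicator {s..} u \<partial>lborel)"
    by (intro nn_integral_cong) (auto simp: indicator_def)
  ultimately show ?thesis by simp
qed

text \<open>Schur's test with the weight \<open>G powr (1 / (p * q))\<close>, the choice that gives the sharp constant.\<close>

lemma hardy_uniform:
  fixes G \<phi> :: "'a \<Rightarrow> real"
  assumes "sigma_finite_measure M"
    and pq: "1 < p" "1 < q" "1 / p + 1 / q = 1"
    and G[measurable]: "G \<in> borel_measurable M" and G01: "\<And>x. 0 < G x" "\<And>x. G x \<le> 1"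
    and unif: "\<And>\<psi> :: real \<Rightarrow> ennreal. \<psi> \<in> borel_measurable borel \<Longrightarrow>
        (\<integral>\<^sup>+x. \<psi> (G x) \<partial>M) \<le> (\<integral>\<^sup>+u. \<psi> u \<partial>lborel)"
    and \<phi>[measurable]: "\<phi> \<in> borel_measurable M" and \<phi>0: "\<And>x. 0 \<le> \<phi> x"
  shows "(\<integral>\<^sup>+x. ennreal ((enn2real (\<integral>\<^sup>+y. ennreal (indicator {..G x} (G y) * \<phi> y) \<partial>M) / G x) powr q) \<partial>M)
      \<le> ennreal (p powr q) * (\<integral>\<^sup>+x. ennreal (\<phi> x powr q) \<partial>M)"
proof (cases "(\<integral>\<^sup>+x. ennreal (\<phi> x powr q) \<partial>M) = \<infinity>")
  case True
  moreover have "ennreal (p powr q) \<noteq> 0" using pq by simp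
  ultimately show ?thesis by (simp add: ennreal_mult_top)
next
  case False
  interpret sigma_finite_measure M by fact
  interpret MM: pair_sigma_finite M M by unfold_locales
  have qp: "q / p = q - 1" "1 - 1 / q = 1 / p" "q * (1 / p) = q - 1"
    using pq by (simp_all add: field_simps)
  \<comment> \<open>The integral of the q-th power of the factor \<open>?u\<close> to which
    Hoelder's inequality is applied below.\<close>
  define Z where "Z x = (\<integral>\<^sup>+y. ennreal (indicator {..G x} (G y) * (\<phi> y powr q * G y powr (1 / p))) \<partial>M)" for x
  have [measurable]: "Measurable.pred (M \<Otimes>\<^sub>M M) (\<lambda>x. G (snd x) \<in> {..G (fst x)})"
    "Measurable.pred (M \<Otimes>\<^sub>M M) (\<lambda>x. G (fst x) \<in> {..G (snd x)})"
    "\<And>x. Measurable.pred M (\<lambda>y. G y \<in> {..G x})" "\<And>y. Measurable.pred M (\<lambda>x. G y \<in> {..G x})"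
    unfolding atMost_iff by measurable
  have Zmeas[measurable]: "Z \<in> borel_measurable M"
    unfolding Z_def[abs_def] by measurable
  \<comment> \<open>Finiteness matters because \<open>enn2real\<close> would turn an infinite
    \<open>Z x\<close> into 0. The bound uses that the weight is at most 1, as \<open>G\<close>
    is.\<close>
  have Zfin: "Z x \<noteq> \<infinity>" for x
  proof -
    have "Z x \<le> (\<integral>\<^sup>+x. ennreal (\<phi> x powr q) \<partial>M)"
      unfolding Z_def
    proof (intro nn_integral_mono ennreal_leI)
      fix y
      have "G y powr (1 / p) \<le> 1" using G01[of y] pq by (intro powr_le1) (auto intro: less_imp_le)
      then have "\<phi> y powr q * G y powr (1 / p) \<le> \<phi> y powr q" by (simp add: mult_left_le)
      then show "indicator {..G x} (G y) * (\<phi> y powr q * G y powr (1 / p)) \<le> \<phi> y powr q"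
        by (auto simp: indicator_def)
    qed
    with False show ?thesis by (auto simp: top_unique)
  qed
  have I1: "(\<integral>\<^sup>+y. ennreal (indicator {..G x} (G y) * G y powr (- (1 / q))) \<partial>M) \<le> ennreal (p * G x powr (1 / p))" for x
  proof -
    have "(\<integral>\<^sup>+y. ennreal (indicator {..G x} (G y) * G y powr (- (1 / q))) \<partial>M)
        = (\<integral>\<^sup>+y. ennreal (indicator {0..G x} (G y) * G y powr (1 / p - 1)) \<partial>M)"
      using G01(1) qp(2) by (intro nn_integral_cong) (auto simp: indicator_def less_imp_le qp(2)[symmetric])
    also have "\<dots> \<le> (\<integral>\<^sup>+u. ennreal (indicator {0..G x} u * u powr (1 / p - 1)) \<partial>lborel)"
      by (rule unif) measurable
    also have "\<dots> = ennreal (p * G x powr (1 / p))"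
      using nn_integral_powr_lower[of "G x" "1 / p"] G01(1)[of x] pq by (simp add: mult.commute)
    finally show ?thesis .
  qed
  \<comment> \<open>On the uniform side the integral runs to infinity instead of 1, which produces
    the pure power on the right.\<close>
  have I2: "(\<integral>\<^sup>+x. ennreal (indicator {..G x} (G y) * G x powr (- 1 - 1 / p)) \<partial>M) \<le> ennreal (p * G y powr (- (1 / p)))" for y
  proof -
    have "(\<integral>\<^sup>+x. ennreal (indicator {..G x} (G y) * G x powr (- 1 - 1 / p)) \<partial>M)
        = (\<integral>\<^sup>+x. ennreal (indicator {G y..} (G x) * G x powr (- 1 - 1 / p)) \<partial>M)"
      by (intro nn_integral_cong) (auto simp: indicator_def)
    also have "\<dots> \<le> (\<integral>\<^sup>+u. ennreal (indicator {G y..} u * u powr (- 1 - 1 / p)) \<partial>lborel)"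
      by (rule unif) measurable
    also have "\<dots> = ennreal (p * G y powr (- (1 / p)))"
      using nn_integral_powr_upper[of "G y" "1 / p"] G01(1)[of y] pq by (simp add: mult.commute)
    finally show ?thesis .
  qed
  \<comment> \<open>Hoelder's inequality for the splitting of \<phi> into
    \<open>\<phi> y * G y powr (1 / (p * q))\<close> and \<open>G y powr (- (1 / (p * q)))\<close>.
    The p-th power of the latter is the integrand of \<open>I1\<close>.\<close>
  have pointwise: "ennreal ((enn2real (\<integral>\<^sup>+y. ennreal (indicator {..G x} (G y) * \<phi> y) \<partial>M) / G x) powr q)
      \<le> ennreal (p powr (q - 1)) * (Z x * ennreal (G x powr (- 1 - 1 / p)))" for x
  proof -
    define z where "z = enn2real (Z x)"
    have z: "Z x = ennreal z" "0 \<le> z" using Zfin[of x] by (auto simp: z_def less_top)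
    define j where "j = enn2real (\<integral>\<^sup>+y. ennreal (indicator {..G x} (G y) * G y powr (- (1 / q))) \<partial>M)"
    have jfin: "(\<integral>\<^sup>+y. ennreal (indicator {..G x} (G y) * G y powr (- (1 / q))) \<partial>M) = ennreal j" "0 \<le> j"
      using le_less_trans[OF I1[of x] ennreal_less_top] by (simp_all add: j_def)
    have jle: "j \<le> p * G x powr (1 / p)"
      using I1[of x] pq unfolding jfin(1) by (simp add: ennreal_le_iff)
    let ?u = "\<lambda>y. indicator {..G x} (G y) * (\<phi> y * G y powr (1 / (p * q)))"
    let ?v = "\<lambda>y. indicator {..G x} (G y) * G y powr (- (1 / (p * q)))"
    have "(\<integral>\<^sup>+y. ennreal (indicator {..G x} (G y) * \<phi> y) \<partial>M) = (\<integral>\<^sup>+y. ennreal \<bar>?u y * ?v y\<bar> \<partial>M)"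
      using \<phi>0 G01(1) by (intro nn_integral_cong) (auto simp: indicator_def powr_minus abs_mult less_imp_neq[symmetric])
    also have "\<dots> \<le> ennreal (z powr (1 / q) * j powr (1 / p))"
    proof (rule holder_real)
      show "1 < q" "1 < p" "1 / q + 1 / p = 1" using pq by auto
      show "(\<integral>\<^sup>+y. ennreal (\<bar>?u y\<bar> powr q) \<partial>M) = ennreal z"
        unfolding z(1)[symmetric] Z_def using \<phi>0 pq
        by (intro nn_integral_cong) (auto simp: indicator_def powr_mult powr_powr abs_mult)
      show "(\<integral>\<^sup>+y. ennreal (\<bar>?v y\<bar> powr p) \<partial>M) = ennreal j"
        unfolding jfin(1)[symmetric] using pq
        by (intro nn_integral_cong) (auto simp: indicator_def powr_powr)
    qed (use z jfin in measurable)
    also have "\<dots> \<le> ennreal (z powr (1 / q) * (p * G x powr (1 / p)) powr (1 / p))"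
      using jle jfin(2) pq by (intro ennreal_leI mult_left_mono powr_mono2) auto
    finally have N: "enn2real (\<integral>\<^sup>+y. ennreal (indicator {..G x} (G y) * \<phi> y) \<partial>M) \<le> z powr (1 / q) * (p * G x powr (1 / p)) powr (1 / p)"
      by (rule enn2real_leI[rotated]) simp
    have "(enn2real (\<integral>\<^sup>+y. ennreal (indicator {..G x} (G y) * \<phi> y) \<partial>M) / G x) powr q
        \<le> (z powr (1 / q) * (p * G x powr (1 / p)) powr (1 / p) / G x) powr q"
      using N G01(1)[of x] pq by (intro powr_mono2 divide_right_mono) (auto intro: less_imp_le)
    also have "\<dots> = p powr (q - 1) * (z * G x powr (- 1 - 1 / p))"
    proof -
      \<comment> \<open>Conjugacy gives \<open>q / p = q - 1\<close>, used twice: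
        \<open>q / (p * p)\<close> is \<open>(q - 1) / p\<close>, which is
        \<open>q - 1 - 1 / p\<close>.\<close>
      have e: "1 / p * (1 / p) * q - q = - 1 - 1 / p"
      proof -
        have "1 / p * (1 / p) * q = 1 / p * (q * (1 / p))" by simp
        also have "\<dots> = 1 / p * q - 1 / p" unfolding qp(3) by (simp add: right_diff_distrib)
        also have "1 / p * q = q - 1" using qp(3) by (simp add: mult.commute)
        finally show ?thesis by simp
      qed
      have "(z powr (1 / q) * (p * G x powr (1 / p)) powr (1 / p) / G x) powr q
          = z * (p powr (1 / p * q) * G x powr (1 / p * (1 / p) * q)) / G x powr q"
        using z(2) pq G01(1)[of x] by (simp add: powr_mult powr_divide powr_powr)
      also have "1 / p * q = q - 1" using qp(3) by (simp add: mult.commute)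
      also have "z * (p powr (q - 1) * G x powr (1 / p * (1 / p) * q)) / G x powr q
          = p powr (q - 1) * (z * G x powr (1 / p * (1 / p) * q - q))"
        by (simp add: powr_diff)
      finally show ?thesis unfolding e .
    qed
    finally show ?thesis
      using z by (simp add: ennreal_mult'[symmetric] ennreal_leI)
  qed
  have "(\<integral>\<^sup>+x. ennreal ((enn2real (\<integral>\<^sup>+y. ennreal (indicator {..G x} (G y) * \<phi> y) \<partial>M) / G x) powr q) \<partial>M)
      \<le> (\<integral>\<^sup>+x. ennreal (p powr (q - 1)) * (Z x * ennreal (G x powr (- 1 - 1 / p))) \<partial>M)"
    by (intro nn_integral_mono pointwise)
  also have "\<dots> = ennreal (p powr (q - 1)) * (\<integral>\<^sup>+x. Z x * ennreal (G x powr (- 1 - 1 / p)) \<partial>M)"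
    by (rule nn_integral_cmult) measurable
  also have "(\<integral>\<^sup>+x. Z x * ennreal (G x powr (- 1 - 1 / p)) \<partial>M)
      = (\<integral>\<^sup>+x. \<integral>\<^sup>+y. ennreal (\<phi> y powr q * G y powr (1 / p)) * ennreal (indicator {..G x} (G y) * G x powr (- 1 - 1 / p)) \<partial>M \<partial>M)"
    unfolding Z_def
    by (subst nn_integral_multc[symmetric])
       (auto intro!: nn_integral_cong simp: indicator_def ennreal_mult'[symmetric])
  also have "\<dots> = (\<integral>\<^sup>+y. \<integral>\<^sup>+x. ennreal (\<phi> y powr q * G y powr (1 / p)) * ennreal (indicator {..G x} (G y) * G x powr (- 1 - 1 / p)) \<partial>M \<partial>M)"
    by (rule MM.Fubini') measurable
  \<comment> \<open>By \<open>I2\<close> the inner integral cancels the weight and leaves one more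
    factor \<open>p\<close>; together with \<open>p powr (q - 1)\<close> from
    \<open>pointwise\<close> this makes \<open>p powr q\<close>.\<close>
  also have "\<dots> \<le> (\<integral>\<^sup>+y. ennreal p * ennreal (\<phi> y powr q) \<partial>M)"
  proof (rule nn_integral_mono)
    fix y
    have "(\<integral>\<^sup>+x. ennreal (\<phi> y powr q * G y powr (1 / p)) * ennreal (indicator {..G x} (G y) * G x powr (- 1 - 1 / p)) \<partial>M)
        = ennreal (\<phi> y powr q * G y powr (1 / p)) * (\<integral>\<^sup>+x. ennreal (indicator {..G x} (G y) * G x powr (- 1 - 1 / p)) \<partial>M)"
      by (rule nn_integral_cmult) measurable
    also have "\<dots> \<le> ennreal (\<phi> y powr q * G y powr (1 / p)) * ennreal (p * G y powr (- (1 / p)))"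
      by (intro mult_left_mono I2) simp
    also have "\<dots> = ennreal p * ennreal (\<phi> y powr q)"
      using G01(1)[of y] pq by (simp add: ennreal_mult'[symmetric] powr_minus field_simps)
    finally show "(\<integral>\<^sup>+x. ennreal (\<phi> y powr q * G y powr (1 / p)) * ennreal (indicator {..G x} (G y) * G x powr (- 1 - 1 / p)) \<partial>M)
        \<le> ennreal p * ennreal (\<phi> y powr q)" .
  qed
  also have "\<dots> = ennreal p * (\<integral>\<^sup>+y. ennreal (\<phi> y powr q) \<partial>M)"
    by (rule nn_integral_cmult) measurable
  finally show ?thesis
    using pq by (simp add: mult_left_mono mult.assoc[symmetric] ennreal_mult'[symmetric] powr_mult_base[symmetric] powr_diff)
qed

section \<open>Probability measures with a positive density\<close>

locale positive_density =
  fixes \<mu> :: "real measure" and f :: "real \<Rightarrow> real"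
  assumes prob: "prob_space \<mu>"
    and f_measurable[measurable]: "f \<in> borel_measurable borel"
    and f_pos: "\<And>x. 0 < f x"
    and density_eq: "\<mu> = density lborel (\<lambda>x. ennreal (f x))"
begin

lemma sets_eq_borel[measurable_cong]: "sets \<mu> = sets borel"
  by (simp add: density_eq)

sublocale real_distribution \<mu>
  by (intro real_distribution.intro prob) (simp add: real_distribution_axioms_def sets_eq_borel)

lemma AE_iff_lborel: "(AE x in \<mu>. P x) \<longleftrightarrow> (AE x in lborel. P x)"
  unfolding density_eq by (subst AE_density) (simp_all add: f_pos)

lemma integrable_iff_lborel:
  fixes u :: "real \<Rightarrow> real"
  assumes "u \<in> borel_measurable borel"
  shows "integrable \<mu> u \<longleftrightarrow> integrable lborel (\<lambda>x. f x * u x)"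
  unfolding density_eq using assms by (subst integrable_density) (simp_all add: f_pos less_imp_le)

lemma integral_eq_lborel:
  fixes u :: "real \<Rightarrow> real"
  assumes "u \<in> borel_measurable borel"
  shows "(\<integral>x. u x \<partial>\<mu>) = (\<integral>x. f x * u x \<partial>lborel)"
  unfolding density_eq using assms by (subst integral_density) (simp_all add: f_pos less_imp_le)

lemma nn_integral_eq_lborel:
  assumes "u \<in> borel_measurable borel"
  shows "(\<integral>\<^sup>+x. u x \<partial>\<mu>) = (\<integral>\<^sup>+x. ennreal (f x) * u x \<partial>lborel)"
  unfolding density_eq using assms by (subst nn_integral_density) simp_all

lemma primitive_diff:
  fixes u :: "real \<Rightarrow> real"
  assumes [measurable]: "u \<in> borel_measurable borel" and int: "integrable \<mu> u" and ab: "a \<le> b"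
  shows "(LINT y:{..b}|\<mu>. u y) - (LINT y:{..a}|\<mu>. u y) = (LINT t:{a..b}|lborel. f t * u t)"
proof -
  have I: "integrable lborel (\<lambda>t. indicat_real S t * (f t * u t))" if [measurable]: "S \<in> sets borel" for S
    using int by (intro integrable_mult_indicator[where 'b = real, simplified]) (simp_all add: integrable_iff_lborel)
  have eq: "(LINT y:{..c}|\<mu>. u y) = (\<integral>t. indicat_real {..c} t * (f t * u t) \<partial>lborel)" for c
    unfolding set_lebesgue_integral_def by (subst integral_eq_lborel) (simp_all add: ac_simps)
  have "(LINT y:{..b}|\<mu>. u y) - (LINT y:{..a}|\<mu>. u y)
      = (\<integral>t. indicat_real {..b} t * (f t * u t) - indicat_real {..a} t * (f t * u t) \<partial>lborel)"
    unfolding eq by (intro Bochner_Integration.integral_diff[symmetric] I) auto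
  also have "\<dots> = (\<integral>t. indicat_real {a..b} t * (f t * u t) \<partial>lborel)"
    using AE_lborel_singleton[of a] ab
    by (intro integral_cong_AE) (auto simp: indicator_def elim!: eventually_mono)
  finally show ?thesis by (simp add: set_lebesgue_integral_def)
qed

lemma set_integrable_density:
  fixes u :: "real \<Rightarrow> real"
  assumes [measurable]: "u \<in> borel_measurable borel" and int: "integrable \<mu> u"
  shows "set_integrable lborel {a..b} (\<lambda>t. f t * u t)"
  unfolding set_integrable_def using int
  by (intro integrable_mult_indicator) (simp_all add: integrable_iff_lborel)

lemma primitive_deriv_AE:
  fixes u :: "real \<Rightarrow> real"
  assumes u: "u \<in> borel_measurable borel" and int: "integrable \<mu> u"
  shows "AE x in lborel. ((\<lambda>x. LINT y:{..x}|\<mu>. u y) has_real_derivative f x * u x) (at x)"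
  using lebesgue_differentiation[OF set_integrable_density[OF u int]]
proof eventually_elim
  case (elim x)
  show ?case
    by (rule elim[rule_format, OF zero_less_one]) (rule primitive_diff[OF u int])
qed

lemma primitive_continuous:
  fixes u :: "real \<Rightarrow> real"
  assumes u: "u \<in> borel_measurable borel" and int: "integrable \<mu> u"
  shows "continuous_on UNIV (\<lambda>x. LINT y:{..x}|\<mu>. u y)"
proof -
  let ?H = "\<lambda>x. LINT y:{..x}|\<mu>. u y"
  have "isCont ?H x" for x
  proof -
    have "continuous_on {x - 1..x + 1} (\<lambda>t. ?H (x - 1) + integral {x - 1..t} (\<lambda>t. f t * u t))"
      by (intro continuous_intros indefinite_integral_continuous_1
          set_borel_integral_eq_integral(1) set_integrable_density u int)
    moreover have "?H t = ?H (x - 1) + integral {x - 1..t} (\<lambda>t. f t * u t)" if "t \<in> {x - 1..x + 1}" for t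
      using primitive_diff[OF u int, of "x - 1" t] that
      by (simp add: set_borel_integral_eq_integral(2)[OF set_integrable_density[OF u int]])
    ultimately have "continuous_on {x - 1..x + 1} ?H"
      by (metis (no_types, lifting) continuous_on_cong)
    then show ?thesis
      by (rule continuous_on_interior) (simp add: interior_atLeastAtMost_real)
  qed
  then show ?thesis by (simp add: continuous_at_imp_continuous_on)
qed

text \<open>Exhibits \<open>F\<close> as the primitive of the constant 1, so that its derivative and
  continuity are special cases.\<close>

lemma cdf_eq_primitive: "cdf \<mu> x = (LINT y:{..x}|\<mu>. 1)"
  by (simp add: cdf_def set_lebesgue_integral_def)

lemma cdf_deriv_AE: "AE x in lborel. (cdf \<mu> has_real_derivative f x) (at x)"
  using primitive_deriv_AE[of "\<lambda>_. 1"] by (simp add: cdf_eq_primitive[abs_def])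

lemma cdf_continuous: "continuous_on UNIV (cdf \<mu>)"
  using primitive_continuous[of "\<lambda>_. 1"] by (simp add: cdf_eq_primitive[abs_def])

lemma measure_singleton: "measure \<mu> {x} = 0"
  using cdf_continuous isCont_cdf[of x] by (simp add: continuous_on_eq_continuous_at)

lemma measure_lessThan: "measure \<mu> {..<x} = cdf \<mu> x"
proof -
  have "cdf \<mu> x = measure \<mu> ({..<x} \<union> {x})"
    unfolding cdf_def by (intro arg_cong[of _ _ "measure \<mu>"]) auto
  also have "\<dots> = measure \<mu> {..<x} + measure \<mu> {x}"
    by (rule finite_measure_Union) auto
  finally show ?thesis by (simp add: measure_singleton)
qed

text \<open>An interval on which \<open>F\<close> is flat would be null for \<mu>, hence Lebesgue
  null because \<open>f\<close> is positive.\<close>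

lemma cdf_strict_mono:
  assumes "x < y"
  shows "cdf \<mu> x < cdf \<mu> y"
proof (rule ccontr)
  assume "\<not> cdf \<mu> x < cdf \<mu> y"
  then have "measure \<mu> {x<..y} = 0"
    using cdf_diff_eq[OF assms] measure_nonneg[of \<mu> "{x<..y}"] by linarith
  then have "{x<..y} \<in> null_sets \<mu>"
    by (auto simp: null_sets_def emeasure_eq_measure)
  then have "AE t in lborel. t \<notin> {x<..y}"
    using AE_not_in AE_iff_lborel by blast
  then have "emeasure lborel {x<..y} = 0"
    by (subst (asm) AE_iff_measurable[of "{x<..y}"]) auto
  then show False using assms by simp
qed

lemma cdf_less_iff: "cdf \<mu> x < cdf \<mu> y \<longleftrightarrow> x < y"
  using cdf_strict_mono cdf_nondecreasing by (meson not_le)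

lemma cdf_le_iff: "cdf \<mu> x \<le> cdf \<mu> y \<longleftrightarrow> x \<le> y"
  using cdf_less_iff by (meson not_le)

lemma cdf_pos: "0 < cdf \<mu> x"
  using cdf_strict_mono[of "x - 1" x] cdf_nonneg[of "x - 1"] by simp

lemma cdf_less_1: "cdf \<mu> x < 1"
  using cdf_strict_mono[of x "x + 1"] cdf_bounded_prob[of "x + 1"] by simp

lemma cdf_surj:
  assumes "0 < u" "u < 1"
  obtains x where "cdf \<mu> x = u"
proof -
  obtain a where a: "cdf \<mu> a < u"
    using order_tendstoD(2)[OF cdf_lim_at_bot assms(1)]
    by (auto simp: eventually_at_bot_linorder)
  obtain b where b: "u < cdf \<mu> b"
    using order_tendstoD(1)[OF cdf_lim_at_top_prob assms(2)]
    by (auto simp: eventually_at_top_linorder)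
  have "a \<le> b" using a b cdf_le_iff by (meson less_imp_le less_trans)
  then show ?thesis
    using IVT'[of "cdf \<mu>" a u b] a b continuous_on_subset[OF cdf_continuous] that by fastforce
qed

text \<open>There are no atoms, so the masses of the two half-lines add up to 1 and neither can
  exceed one half.\<close>

lemma cdf_median:
  assumes "is_median \<mu> m"
  shows "cdf \<mu> m = 1 / 2"
proof -
  have "measure \<mu> {m..} = 1 - measure \<mu> {..<m}"
    using prob_compl[of "{..<m}"] by (simp add: Compl_eq_Diff_UNIV[symmetric])
  then show ?thesis using assms
    by (simp add: is_median_def measure_lessThan) (simp add: cdf_def)
qed

text \<open>Enlarging \<open>{..x}\<close> by \<open>r\<close> gives \<open>{..<x + r}\<close>, so
  the boundary measure of this half-line is the right derivative of \<open>F\<close> at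
  \<open>x\<close>.\<close>

lemma isoperimetric_density:
  assumes "isoperimetric \<mu> c"
  shows "AE x in lborel. c * ennreal (min (cdf \<mu> x) (1 - cdf \<mu> x)) \<le> ennreal (f x)"
  using cdf_deriv_AE
proof eventually_elim
  case (elim x)
  have enl: "measure \<mu> (enlargement {..x} r) = cdf \<mu> (x + r)" if "0 < r" for r
  proof -
    have "enlargement {..x} r = {..<x + r}"
    proof (intro set_eqI iffI)
      fix t assume "t \<in> {..<x + r}"
      then show "t \<in> enlargement {..x} r"
        unfolding enlargement_def using that
        by (auto intro!: bexI[of _ "min t x"] simp: min_def)
    qed (auto simp: enlargement_def)
    then show ?thesis by (simp add: measure_lessThan)
  qed
  have "((\<lambda>r. (cdf \<mu> (x + r) - cdf \<mu> x) / r) \<longlongrightarrow> f x) (at_right 0)"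
    using elim unfolding DERIV_def by (rule filterlim_mono) (simp_all add: at_within_le_at)
  then have "((\<lambda>r. ennreal ((cdf \<mu> (x + r) - cdf \<mu> x) / r)) \<longlongrightarrow> ennreal (f x)) (at_right 0)"
    by (rule tendsto_ennrealI)
  moreover have "\<forall>\<^sub>F r in at_right 0. ennreal ((cdf \<mu> (x + r) - cdf \<mu> x) / r)
      = ennreal ((measure \<mu> (enlargement {..x} r) - measure \<mu> {..x}) / r)"
    using eventually_at_right_less[of 0] by eventually_elim (simp add: enl cdf_def)
  ultimately have "((\<lambda>r. ennreal ((measure \<mu> (enlargement {..x} r) - measure \<mu> {..x}) / r)) \<longlongrightarrow> ennreal (f x)) (at_right 0)"
    by (rule Lim_transform_eventually)
  then have "boundary_measure \<mu> {..x} = ennreal (f x)"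
    unfolding boundary_measure_def by (intro lim_imp_Liminf) auto
  moreover have "c * ennreal (min (measure \<mu> {..x}) (1 - measure \<mu> {..x})) \<le> boundary_measure \<mu> {..x}"
    using assms by (auto simp: isoperimetric_def)
  ultimately show ?case by (simp add: cdf_def)
qed

text \<open>At a point where \<open>isoperimetric_density\<close> holds, \<open>f\<close> is finite
  while the minimum is positive. Consequently \<open>inverse (Is_const \<mu>)\<close> is never 0, on
  which the infinite case of \<open>cov_bounds\<close> relies.\<close>

lemma Is_const_finite: "Is_const \<mu> < \<infinity>"
proof -
  have "\<exists>x. Is_const \<mu> * ennreal (min (cdf \<mu> x) (1 - cdf \<mu> x)) \<le> ennreal (f x)"
  proof (rule ccontr)
    assume "\<not> ?thesis"
    then have "AE x in lborel. (x :: real) \<in> {}"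
      using isoperimetric_density[OF isoperimetric_Is_const] by (auto elim!: eventually_mono)
    then have "emeasure lborel (UNIV :: real set) = 0"
      by (subst (asm) AE_iff_measurable[of UNIV]) auto
    then show False by simp
  qed
  then obtain x where x: "Is_const \<mu> * ennreal (min (cdf \<mu> x) (1 - cdf \<mu> x)) \<le> ennreal (f x)" ..
  have "ennreal (min (cdf \<mu> x) (1 - cdf \<mu> x)) \<noteq> 0" using cdf_pos[of x] cdf_less_1[of x] by simp
  then have "Is_const \<mu> \<noteq> \<infinity>"
    using x by (auto simp: ennreal_top_mult top_unique simp del: ennreal_eq_0_iff)
  then show ?thesis by (simp add: less_top)
qed

text \<open>The probability integral transform. \<open>F\<close> maps the line increasingly onto the
  open unit interval, so its sublevel set at a level \<open>u\<close> in that interval is a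
  half-line of mass \<open>u\<close>.\<close>

lemma distr_cdf: "distr \<mu> borel (cdf \<mu>) = uniform_measure lborel {0..1}"
proof (rule cdf_unique)
  have [measurable]: "cdf \<mu> \<in> borel_measurable borel"
    by (rule borel_measurable_continuous_onI[OF cdf_continuous])
  show "real_distribution (distr \<mu> borel (cdf \<mu>))"
    by (rule real_distribution_distr) measurable
  show "real_distribution (uniform_measure lborel {0..1})"
    by (intro real_distribution.intro prob_space_uniform_measure) (simp_all add: real_distribution_axioms_def)
  show "cdf (distr \<mu> borel (cdf \<mu>)) = cdf (uniform_measure lborel {0..1})"
  proof
    fix u :: real
    have L: "cdf (distr \<mu> borel (cdf \<mu>)) u = measure \<mu> {x. cdf \<mu> x \<le> u}"
      unfolding cdf_def[of "distr \<mu> borel (cdf \<mu>)"] by (subst measure_distr) (auto simp: vimage_def)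
    have R: "cdf (uniform_measure lborel {0..1}) u = measure lborel ({0..1} \<inter> {..u})"
      by (simp add: cdf_def measure_uniform_measure)
    consider "u \<le> 0" | "0 < u" "u < 1" | "1 \<le> u" by linarith
    then show "cdf (distr \<mu> borel (cdf \<mu>)) u = cdf (uniform_measure lborel {0..1}) u"
    proof cases
      case 1
      then have "{x. cdf \<mu> x \<le> u} = {}" using cdf_pos by (auto simp: not_le) (meson le_less_trans not_less_iff_gr_or_eq order.strict_trans2)
      moreover have "measure lborel ({0..1} \<inter> {..u}) = 0"
        using 1 by simp
      ultimately show ?thesis by (simp add: L R)
    next
      case 2
      then obtain x where x: "cdf \<mu> x = u" by (rule cdf_surj)
      have "{t. cdf \<mu> t \<le> u} = {..x}" using cdf_le_iff x by auto
      moreover have "{0..1} \<inter> {..u} = {0..u}" using 2 by auto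
      ultimately show ?thesis using x[unfolded cdf_def] 2 by (simp add: L R)
    next
      case 3
      then have "{x. cdf \<mu> x \<le> u} = UNIV" using cdf_bounded_prob by (auto intro: order_trans)
      moreover have "{0..1} \<inter> {..u} = {0..1}" using 3 by auto
      ultimately show ?thesis using prob_space by (simp add: L R)
    qed
  qed
qed

text \<open>The transport hypothesis of \<open>hardy_uniform\<close> for \<open>G = F\<close>;
  replacing the unit interval by the whole line turns equality into an inequality.\<close>

lemma nn_integral_cdf_le:
  assumes [measurable]: "\<psi> \<in> borel_measurable borel"
  shows "(\<integral>\<^sup>+x. \<psi> (cdf \<mu> x) \<partial>\<mu>) \<le> (\<integral>\<^sup>+u. \<psi> u \<partial>lborel)"
proof -
  have [measurable]: "cdf \<mu> \<in> borel_measurable borel"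
    by (rule borel_measurable_continuous_onI[OF cdf_continuous])
  have "(\<integral>\<^sup>+x. \<psi> (cdf \<mu> x) \<partial>\<mu>) = (\<integral>\<^sup>+u. \<psi> u \<partial>distr \<mu> borel (cdf \<mu>))"
    by (subst nn_integral_distr) auto
  also have "\<dots> = (\<integral>\<^sup>+u. indicator {0..1} u * \<psi> u \<partial>lborel)"
    unfolding distr_cdf uniform_measure_def
    by (subst nn_integral_density) (auto simp: divide_ennreal_def)
  also have "\<dots> \<le> (\<integral>\<^sup>+u. \<psi> u \<partial>lborel)"
    by (intro nn_integral_mono) (simp add: indicator_def)
  finally show ?thesis .
qed

text \<open>If \<open>F\<close> is uniformly distributed then so is \<open>1 - F\<close>. This
  version serves the side to the right of \<open>m\<close>.\<close>

lemma nn_integral_survival_le: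
  assumes [measurable]: "\<psi> \<in> borel_measurable borel"
  shows "(\<integral>\<^sup>+x. \<psi> (1 - cdf \<mu> x) \<partial>\<mu>) \<le> (\<integral>\<^sup>+u. \<psi> u \<partial>lborel)"
proof -
  have "(\<integral>\<^sup>+x. \<psi> (1 - cdf \<mu> x) \<partial>\<mu>) \<le> (\<integral>\<^sup>+u. \<psi> (1 - u) \<partial>lborel)"
    using nn_integral_cdf_le[of "\<lambda>u. \<psi> (1 - u)"] by simp
  also have "\<dots> = (\<integral>\<^sup>+u. \<psi> u \<partial>lborel)"
    using nn_integral_real_affine[of \<psi> "-1" 1] by simp
  finally show ?thesis .
qed

section \<open>The averaging operator\<close>

text \<open>Since \<open>F\<close> lies strictly between 0 and 1 everywhere, both ends of the
  support are infinite, and the indicators only compare \<open>x\<close> with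
  \<open>m\<close>.\<close>

lemma T_op_eq:
  "T_op \<mu> (ereal m) u x = (if x \<le> m then (LINT y:{..x}|\<mu>. u y) / cdf \<mu> x
     else (LINT y:{x<..}|\<mu>. u y) / (1 - cdf \<mu> x))"
proof -
  have "(INF x. ereal x) \<le> ereal x" "ereal x \<le> (SUP x. ereal x)" for x
    by (rule INF_lower SUP_upper, simp)+
  then have "lower_end \<mu> = - \<infinity>" "upper_end \<mu> = \<infinity>"
    using cdf_pos cdf_less_1
    by (auto simp: lower_end_def upper_end_def full_SetCompr_eq intro!: ereal_bot ereal_top)
  then show ?thesis
    by (auto simp: T_op_def indicator_def atMost_def greaterThan_def)
qed

lemma cdf_measurable[measurable]: "cdf \<mu> \<in> borel_measurable borel"
  by (rule borel_measurable_continuous_onI[OF cdf_continuous])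

lemma T_op_measurable:
  assumes [measurable]: "u \<in> borel_measurable borel"
  shows "T_op \<mu> (ereal m) u \<in> borel_measurable borel"
proof -
  \<comment> \<open>In this form each branch is a parametrized integral of a jointly measurable
    function, so it is measurable in \<open>x\<close>.\<close>
  have "T_op \<mu> (ereal m) u = (\<lambda>x. if x \<le> m then (\<integral>y. (if y \<le> x then u y else 0) \<partial>\<mu>) / cdf \<mu> x
     else (\<integral>y. (if x < y then u y else 0) \<partial>\<mu>) / (1 - cdf \<mu> x))"
    unfolding T_op_eq[abs_def] set_lebesgue_integral_def
    by (intro ext) (auto intro!: Bochner_Integration.integral_cong arg_cong2[where f = "(/)"] simp: indicator_def)
  then show ?thesis by simp
qed

lemma abs_set_integral_le:
  fixes u :: "real \<Rightarrow> real"
  assumes [measurable]: "u \<in> borel_measurable borel" and int: "integrable \<mu> u" and [measurable]: "S \<in> sets borel"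
  shows "ennreal \<bar>LINT y:S|\<mu>. u y\<bar> \<le> (\<integral>\<^sup>+y. ennreal (indicator S y * \<bar>u y\<bar>) \<partial>\<mu>)"
    and "(\<integral>\<^sup>+y. ennreal (indicator S y * \<bar>u y\<bar>) \<partial>\<mu>) = ennreal (LINT y:S|\<mu>. \<bar>u y\<bar>)"
proof -
  have I: "integrable \<mu> (\<lambda>y. indicator S y * u y)"
    using int by (intro integrable_mult_indicator[where 'b = real, simplified]) auto
  have abs: "\<bar>indicator S y * u y\<bar> = indicator S y * \<bar>u y\<bar>" for y
    by (simp add: abs_mult)
  have eq: "(\<integral>\<^sup>+y. ennreal (indicator S y * \<bar>u y\<bar>) \<partial>\<mu>) = ennreal (\<integral>y. indicator S y * \<bar>u y\<bar> \<partial>\<mu>)"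
    using integrable_abs[OF I] unfolding abs by (intro nn_integral_eq_integral) auto
  then show "(\<integral>\<^sup>+y. ennreal (indicator S y * \<bar>u y\<bar>) \<partial>\<mu>) = ennreal (LINT y:S|\<mu>. \<bar>u y\<bar>)"
    by (simp add: set_lebesgue_integral_def)
  have "\<bar>\<integral>y. indicator S y * u y \<partial>\<mu>\<bar> \<le> (\<integral>y. indicator S y * \<bar>u y\<bar> \<partial>\<mu>)"
    using integral_abs_bound[of \<mu> "\<lambda>y. indicator S y * u y"] unfolding abs .
  then show "ennreal \<bar>LINT y:S|\<mu>. u y\<bar> \<le> (\<integral>\<^sup>+y. ennreal (indicator S y * \<bar>u y\<bar>) \<partial>\<mu>)"
    unfolding eq by (simp add: set_lebesgue_integral_def ennreal_leI)
qed

text \<open>The endpoint \<open>p = 1\<close> of Hardy's inequality: \<open>T_op\<close> averages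
  \<open>u\<close> over a half-line with respect to \<mu>, and averages obey the same essential
  bound.\<close>

lemma T_op_esssup_le:
  assumes [measurable]: "u \<in> borel_measurable borel" and int: "integrable \<mu> u"
  shows "Lp_norm \<mu> \<infinity> (T_op \<mu> (ereal m) u) \<le> Lp_norm \<mu> \<infinity> u"
proof (cases "esssup \<mu> (\<lambda>x. ennreal \<bar>u x\<bar>)")
  case (real s)
  have [measurable]: "T_op \<mu> (ereal m) u \<in> borel_measurable borel"
    by (rule T_op_measurable) measurable
  have ae: "AE y in \<mu>. \<bar>u y\<bar> \<le> s"
    using esssup_AE[of "\<lambda>x. ennreal \<bar>u x\<bar>" \<mu>] real by (simp add: ennreal_le_iff)
  have bound: "\<bar>LINT y:S|\<mu>. u y\<bar> \<le> s * measure \<mu> S" if [measurable]: "S \<in> sets borel" for S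
  proof -
    have "ennreal \<bar>LINT y:S|\<mu>. u y\<bar> \<le> (\<integral>\<^sup>+y. ennreal (indicator S y * \<bar>u y\<bar>) \<partial>\<mu>)"
      by (rule abs_set_integral_le) (use int in measurable)
    also have "\<dots> \<le> (\<integral>\<^sup>+y. ennreal s * indicator S y \<partial>\<mu>)"
      using ae by (intro nn_integral_mono_AE) (auto simp: indicator_def ennreal_leI elim!: eventually_mono)
    also have "\<dots> = ennreal s * emeasure \<mu> S"
      by (rule nn_integral_cmult_indicator) measurable
    also have "\<dots> = ennreal (s * measure \<mu> S)"
      using real by (simp add: emeasure_eq_measure ennreal_mult)
    finally show ?thesis using real by (subst (asm) ennreal_le_iff) auto
  qed
  have gt: "measure \<mu> {x<..} = 1 - cdf \<mu> x" for x
    using prob_compl[of "{..x}"] by (simp add: cdf_def Compl_eq_Diff_UNIV[symmetric])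
  have le: "measure \<mu> {..x} = cdf \<mu> x" for x
    by (simp add: cdf_def)
  have "\<bar>T_op \<mu> (ereal m) u x\<bar> \<le> s" for x
    using bound[of "{..x}"] bound[of "{x<..}"] cdf_pos[of x] cdf_less_1[of x]
    by (auto simp: T_op_eq abs_divide gt le field_simps)
  then show ?thesis
    using real by (auto simp: Lp_norm_def intro!: esssup_I ennreal_leI)
qed (simp add: Lp_norm_def)

text \<open>Left of \<open>m\<close> the averages see only values of \<open>u\<close> left of
  \<open>m\<close>, and likewise on the right. Hardy's inequality is applied to the two pieces of
  \<open>u\<close>, with \<open>F\<close> and with \<open>1 - F\<close>; as the pieces have disjoint
  supports, the q-th powers add up without loss in the constant.\<close>

lemma T_op_hardy_real:
  assumes pq: "1 < p" "1 < q" "1 / p + 1 / q = 1"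
    and u[measurable]: "u \<in> borel_measurable borel" and int: "integrable \<mu> u"
  shows "(\<integral>\<^sup>+x. ennreal (\<bar>T_op \<mu> (ereal m) u x\<bar> powr q) \<partial>\<mu>)
    \<le> ennreal (p powr q) * (\<integral>\<^sup>+x. ennreal (\<bar>u x\<bar> powr q) \<partial>\<mu>)"
proof -
  define G where "G x = 1 - cdf \<mu> x" for x
  have G[measurable]: "G \<in> borel_measurable borel" unfolding G_def[abs_def] by measurable
  define u1 u2 where "u1 y = indicator {..m} y * \<bar>u y\<bar>" and "u2 y = indicator {m<..} y * \<bar>u y\<bar>" for y
  have [measurable]: "u1 \<in> borel_measurable borel" "u2 \<in> borel_measurable borel"
    unfolding u1_def[abs_def] u2_def[abs_def] by measurable
  \<comment> \<open>As \<open>F\<close> is strictly increasing, the indicators describe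
    \<open>{..x}\<close> and \<open>{x..}\<close>. The point \<open>x\<close>, absent from
    \<open>{x<..}\<close> in \<open>T_op\<close>, does no harm to an upper bound.\<close>
  define N1 N2 where "N1 x = (\<integral>\<^sup>+y. ennreal (indicator {..cdf \<mu> x} (cdf \<mu> y) * u1 y) \<partial>\<mu>)"
    and "N2 x = (\<integral>\<^sup>+y. ennreal (indicator {..G x} (G y) * u2 y) \<partial>\<mu>)" for x
  have sf: "sigma_finite_measure \<mu>" by unfold_locales
  have H1: "(\<integral>\<^sup>+x. ennreal ((enn2real (N1 x) / cdf \<mu> x) powr q) \<partial>\<mu>) \<le> ennreal (p powr q) * (\<integral>\<^sup>+x. ennreal (u1 x powr q) \<partial>\<mu>)"
    unfolding N1_def
    by (rule hardy_uniform[OF sf pq])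
       (auto simp: cdf_pos cdf_less_1 less_imp_le u1_def intro: nn_integral_cdf_le)
  have H2: "(\<integral>\<^sup>+x. ennreal ((enn2real (N2 x) / G x) powr q) \<partial>\<mu>) \<le> ennreal (p powr q) * (\<integral>\<^sup>+x. ennreal (u2 x powr q) \<partial>\<mu>)"
    unfolding N2_def
    by (rule hardy_uniform[OF sf pq])
       (auto simp: G_def cdf_pos cdf_less_1 less_imp_le u2_def intro: nn_integral_survival_le)
  have Nmeas[measurable]: "N1 \<in> borel_measurable borel" "N2 \<in> borel_measurable borel"
  proof -
    have "Measurable.pred (borel \<Otimes>\<^sub>M \<mu>) (\<lambda>x. cdf \<mu> (snd x) \<in> {..cdf \<mu> (fst x)})"
      "Measurable.pred (borel \<Otimes>\<^sub>M \<mu>) (\<lambda>x. G (snd x) \<in> {..G (fst x)})"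
      unfolding atMost_iff by measurable
    note [measurable] = this
    show "N1 \<in> borel_measurable borel" "N2 \<in> borel_measurable borel"
      unfolding N1_def[abs_def] N2_def[abs_def] by measurable
  qed
  have fin: "(\<integral>\<^sup>+y. ennreal \<bar>u y\<bar> \<partial>\<mu>) < top"
    using int by (simp add: integrable_iff_bounded)
  have le1: "\<bar>T_op \<mu> (ereal m) u x\<bar> \<le> enn2real (N1 x) / cdf \<mu> x" if "x \<le> m" for x
  proof -
    have "ennreal \<bar>LINT y:{..x}|\<mu>. u y\<bar> \<le> (\<integral>\<^sup>+y. ennreal (indicator {..x} y * \<bar>u y\<bar>) \<partial>\<mu>)"
      by (rule abs_set_integral_le(1)[OF u int]) measurable
    also have "\<dots> \<le> N1 x"
      unfolding N1_def using that
      by (intro nn_integral_mono ennreal_leI) (auto simp: u1_def indicator_def cdf_le_iff)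
    finally have "ennreal \<bar>LINT y:{..x}|\<mu>. u y\<bar> \<le> N1 x" .
    moreover have "N1 x \<le> (\<integral>\<^sup>+y. ennreal \<bar>u y\<bar> \<partial>\<mu>)"
      unfolding N1_def by (intro nn_integral_mono ennreal_leI) (auto simp: u1_def indicator_def)
    ultimately have "\<bar>LINT y:{..x}|\<mu>. u y\<bar> \<le> enn2real (N1 x)"
      using fin enn2real_mono[of "ennreal \<bar>LINT y:{..x}|\<mu>. u y\<bar>" "N1 x"] by simp
    then show ?thesis using that cdf_pos[of x] by (simp add: T_op_eq abs_divide divide_right_mono)
  qed
  have le2: "\<bar>T_op \<mu> (ereal m) u x\<bar> \<le> enn2real (N2 x) / G x" if "m < x" for x
  proof -
    have "ennreal \<bar>LINT y:{x<..}|\<mu>. u y\<bar> \<le> (\<integral>\<^sup>+y. ennreal (indicator {x<..} y * \<bar>u y\<bar>) \<partial>\<mu>)"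
      by (rule abs_set_integral_le(1)[OF u int]) measurable
    also have "\<dots> \<le> N2 x"
      unfolding N2_def using that
      by (intro nn_integral_mono ennreal_leI) (auto simp: u2_def G_def indicator_def cdf_le_iff)
    finally have "ennreal \<bar>LINT y:{x<..}|\<mu>. u y\<bar> \<le> N2 x" .
    moreover have "N2 x \<le> (\<integral>\<^sup>+y. ennreal \<bar>u y\<bar> \<partial>\<mu>)"
      unfolding N2_def by (intro nn_integral_mono ennreal_leI) (auto simp: u2_def indicator_def)
    ultimately have "\<bar>LINT y:{x<..}|\<mu>. u y\<bar> \<le> enn2real (N2 x)"
      using fin enn2real_mono[of "ennreal \<bar>LINT y:{x<..}|\<mu>. u y\<bar>" "N2 x"] by simp
    then show ?thesis using that cdf_less_1[of x] by (simp add: T_op_eq G_def abs_divide divide_right_mono)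
  qed
  have "(\<integral>\<^sup>+x. ennreal (\<bar>T_op \<mu> (ereal m) u x\<bar> powr q) \<partial>\<mu>)
      \<le> (\<integral>\<^sup>+x. ennreal ((enn2real (N1 x) / cdf \<mu> x) powr q) + ennreal ((enn2real (N2 x) / G x) powr q) \<partial>\<mu>)"
  proof (rule nn_integral_mono)
    fix x
    show "ennreal (\<bar>T_op \<mu> (ereal m) u x\<bar> powr q)
        \<le> ennreal ((enn2real (N1 x) / cdf \<mu> x) powr q) + ennreal ((enn2real (N2 x) / G x) powr q)"
    proof (cases "x \<le> m")
      case True
      from le1[OF True] pq show ?thesis
        by (intro order_trans[OF _ add_increasing2[OF _ order_refl]] ennreal_leI powr_mono2) auto
    next
      case False
      with le2[of x] pq show ?thesis
        by (intro order_trans[OF _ add_increasing[OF _ order_refl]] ennreal_leI powr_mono2) auto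
    qed
  qed
  also have "\<dots> = (\<integral>\<^sup>+x. ennreal ((enn2real (N1 x) / cdf \<mu> x) powr q) \<partial>\<mu>) + (\<integral>\<^sup>+x. ennreal ((enn2real (N2 x) / G x) powr q) \<partial>\<mu>)"
    by (rule nn_integral_add) measurable
  also have "\<dots> \<le> ennreal (p powr q) * (\<integral>\<^sup>+x. ennreal (u1 x powr q) \<partial>\<mu>) + ennreal (p powr q) * (\<integral>\<^sup>+x. ennreal (u2 x powr q) \<partial>\<mu>)"
    by (intro add_mono H1 H2)
  also have "\<dots> = ennreal (p powr q) * (\<integral>\<^sup>+x. ennreal (u1 x powr q) + ennreal (u2 x powr q) \<partial>\<mu>)"
    by (simp add: nn_integral_add distrib_left)
  also have "(\<integral>\<^sup>+x. ennreal (u1 x powr q) + ennreal (u2 x powr q) \<partial>\<mu>) = (\<integral>\<^sup>+x. ennreal (\<bar>u x\<bar> powr q) \<partial>\<mu>)"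
    by (intro nn_integral_cong) (auto simp: u1_def u2_def indicator_def)
  finally show ?thesis .
qed

lemma T_op_hardy:
  assumes pq: "1 \<le> p" "p < \<infinity>" "inverse p + inverse q = 1"
    and u: "u \<in> borel_measurable borel" and int: "integrable \<mu> u"
  shows "Lp_norm \<mu> q (T_op \<mu> (ereal m) u) \<le> p * Lp_norm \<mu> q u"
  using pq
proof (cases rule: ennreal_conjugate_cases)
  case 1
  then show ?thesis using T_op_esssup_le[OF u int] by simp
next
  case (2 p' q')
  let ?I = "\<integral>\<^sup>+x. ennreal (\<bar>u x\<bar> powr q') \<partial>\<mu>" and ?J = "\<integral>\<^sup>+x. ennreal (\<bar>T_op \<mu> (ereal m) u x\<bar> powr q') \<partial>\<mu>"
  have J: "?J \<le> ennreal (p' powr q') * ?I"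
    by (rule T_op_hardy_real[OF 2(3-5) u int])
  show ?thesis
  proof (cases "?I = \<infinity>")
    case True
    then have "Lp_norm \<mu> q u = \<infinity>" using 2 by (simp add: Lp_norm_ennreal)
    then show ?thesis using 2 by (simp add: ennreal_mult_top)
  next
    case False
    then obtain i where i: "?I = ennreal i" "0 \<le> i" by (cases ?I) auto
    then have J': "?J \<le> ennreal (p' powr q' * i)" using J by (simp add: ennreal_mult')
    then obtain j where j: "?J = ennreal j" "0 \<le> j" by (cases ?J) (auto simp: top_unique)
    have "j \<le> p' powr q' * i" using J' i unfolding j(1) by (subst (asm) ennreal_le_iff) auto
    then have "j powr (1 / q') \<le> (p' powr q' * i) powr (1 / q')"
      using j 2 by (intro powr_mono2) auto
    also have "\<dots> = p' * i powr (1 / q')"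
      using i 2 by (simp add: powr_mult powr_powr)
    finally show ?thesis
      using i j 2 by (simp add: Lp_norm_ennreal ennreal_mult'[symmetric] ennreal_leI)
  qed
qed

end

section \<open>The covariance inequality\<close>

context positive_density
begin

text \<open>Hoelder's inequality against the constant 1, whose norm is 1 for a probability
  measure.\<close>

lemma Lp_space_imp_integrable:
  assumes pq: "1 \<le> p" "p < \<infinity>" "inverse p + inverse q = 1"
    and h: "h \<in> Lp_space \<mu> q"
  shows "h \<in> borel_measurable borel" "integrable \<mu> h"
proof -
  show hm: "h \<in> borel_measurable borel" using h by (simp add: Lp_space_def cong: measurable_cong_sets)
  then have [measurable]: "h \<in> borel_measurable borel" .
  have "Lp_norm \<mu> p (\<lambda>_. 1) = 1"
    using pq(2) emeasure_space_1 by (simp add: Lp_norm_def)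
  then have "(\<integral>\<^sup>+x. ennreal \<bar>1 * h x\<bar> \<partial>\<mu>) \<le> Lp_norm \<mu> q h"
    using Lp_norm_holder[OF pq, of "\<lambda>_. 1" \<mu> h] by simp
  also have "\<dots> < \<infinity>" using h by (simp add: Lp_space_def)
  finally show "integrable \<mu> h" by (simp add: integrable_iff_bounded)
qed

lemma Lp_norm_centered_finite:
  assumes pq: "1 \<le> p" "p < \<infinity>" "inverse p + inverse q = 1"
    and h: "h \<in> Lp_space \<mu> q"
  shows "Lp_norm \<mu> q (centered \<mu> h) < \<infinity>"
proof -
  have [measurable]: "h \<in> borel_measurable borel" by (rule Lp_space_imp_integrable[OF assms])
  define c where "c = (\<integral>y. h y \<partial>\<mu>)"
  have fin: "Lp_norm \<mu> q h < \<infinity>" using h by (simp add: Lp_space_def)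
  show ?thesis
    using pq
  proof (cases rule: ennreal_conjugate_cases)
    case 1
    have "esssup \<mu> (\<lambda>x. ennreal \<bar>centered \<mu> h x\<bar>) \<le> esssup \<mu> (\<lambda>x. ennreal \<bar>h x\<bar>) + ennreal \<bar>c\<bar>"
    proof (rule esssup_I)
      show "(\<lambda>x. ennreal \<bar>centered \<mu> h x\<bar>) \<in> borel_measurable \<mu>"
        unfolding centered_def by measurable
      show "AE x in \<mu>. ennreal \<bar>centered \<mu> h x\<bar> \<le> esssup \<mu> (\<lambda>x. ennreal \<bar>h x\<bar>) + ennreal \<bar>c\<bar>"
        using esssup_AE[of "\<lambda>x. ennreal \<bar>h x\<bar>" \<mu>]
      proof eventually_elim
        case (elim x)
        have "ennreal \<bar>centered \<mu> h x\<bar> \<le> ennreal (\<bar>h x\<bar> + \<bar>c\<bar>)"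
          by (intro ennreal_leI) (simp add: centered_def c_def)
        also have "\<dots> = ennreal \<bar>h x\<bar> + ennreal \<bar>c\<bar>" by simp
        also have "\<dots> \<le> esssup \<mu> (\<lambda>x. ennreal \<bar>h x\<bar>) + ennreal \<bar>c\<bar>"
          using elim by (rule add_right_mono)
        finally show ?case .
      qed
    qed
    also have "\<dots> < \<infinity>" using fin 1 by (simp add: Lp_norm_def)
    finally show ?thesis using 1 by (simp add: Lp_norm_def)
  next
    case (2 p' q')
    have "(\<integral>\<^sup>+x. ennreal (\<bar>h x\<bar> powr q') \<partial>\<mu>) \<noteq> \<infinity>"
      using fin 2 by (auto simp: Lp_norm_ennreal)
    then have I: "(\<integral>\<^sup>+x. ennreal (\<bar>h x\<bar> powr q') \<partial>\<mu>) < \<infinity>" by (simp add: less_top)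
    have "(\<integral>\<^sup>+x. ennreal (\<bar>centered \<mu> h x\<bar> powr q') \<partial>\<mu>)
        \<le> (\<integral>\<^sup>+x. ennreal (2 powr q') * (ennreal (\<bar>h x\<bar> powr q') + ennreal (\<bar>c\<bar> powr q')) \<partial>\<mu>)"
    proof (rule nn_integral_mono)
      fix x
      \<comment> \<open>A crude substitute for Minkowski's inequality, as only finiteness
        matters.\<close>
      have "\<bar>centered \<mu> h x\<bar> powr q' \<le> (2 * max \<bar>h x\<bar> \<bar>c\<bar>) powr q'"
        using 2 by (intro powr_mono2) (auto simp: centered_def c_def)
      also have "\<dots> = 2 powr q' * max \<bar>h x\<bar> \<bar>c\<bar> powr q'" by (simp add: powr_mult)
      also have "\<dots> \<le> 2 powr q' * (\<bar>h x\<bar> powr q' + \<bar>c\<bar> powr q')"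
        by (intro mult_left_mono) (auto simp: max_def)
      finally show "ennreal (\<bar>centered \<mu> h x\<bar> powr q') \<le> ennreal (2 powr q') * (ennreal (\<bar>h x\<bar> powr q') + ennreal (\<bar>c\<bar> powr q'))"
        by (simp add: ennreal_mult'[symmetric] ennreal_plus[symmetric] ennreal_leI del: ennreal_plus)
    qed
    also have "\<dots> = ennreal (2 powr q') * ((\<integral>\<^sup>+x. ennreal (\<bar>h x\<bar> powr q') \<partial>\<mu>) + ennreal (\<bar>c\<bar> powr q'))"
      using emeasure_space_1 by (simp add: nn_integral_cmult nn_integral_add)
    also have "\<dots> < \<infinity>"
      using I by (simp add: ennreal_mult_less_top)
    finally show ?thesis using 2 by (simp add: Lp_norm_ennreal)
  qed
qed

text \<open>As a function of \<open>t\<close>, the signed indicator of the interval between \<open>m\<close> and \<open>x\<close>.\<close>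

definition rearrangement_kernel :: "real \<Rightarrow> real \<Rightarrow> real \<Rightarrow> real" where
  "rearrangement_kernel m t x = (if m < t then (if t < x then 1 else 0) else (if x \<le> t then - 1 else 0))"

lemma cov_eq_0_const:
  assumes h: "h \<in> borel_measurable borel" "integrable \<mu> h" and "\<And>x. g x = c"
  shows "cov \<mu> g h = 0"
  using assms prob_space by (simp add: cov_def centered_def)

lemma cov_eq_0_AE:
  assumes h: "h \<in> borel_measurable borel" and "AE x in \<mu>. centered \<mu> h x = 0"
  shows "cov \<mu> g h = 0"
proof -
  have "(\<integral>x. g x * centered \<mu> h x \<partial>\<mu>) = (\<integral>x. 0 \<partial>\<mu>)"
    using assms(2) by (intro integral_eq_zero_AE[THEN trans]) (auto elim!: eventually_mono)
  then show ?thesis by (simp add: cov_def)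
qed

lemma integral_centered:
  assumes "integrable \<mu> h"
  shows "integrable \<mu> (centered \<mu> h)" "(\<integral>x. centered \<mu> h x \<partial>\<mu>) = 0"
  using assms prob_space by (simp_all add: centered_def[abs_def])

lemma integral_greaterThan:
  fixes u :: "real \<Rightarrow> real"
  assumes [measurable]: "u \<in> borel_measurable borel" and int: "integrable \<mu> u"
  shows "(LINT y:{x<..}|\<mu>. u y) = (\<integral>y. u y \<partial>\<mu>) - (LINT y:{..x}|\<mu>. u y)"
proof -
  have I: "integrable \<mu> (\<lambda>y. indicator {..x} y * u y)"
    using int by (intro integrable_mult_indicator[where 'b = real, simplified]) auto
  have "(LINT y:{x<..}|\<mu>. u y) = (\<integral>y. u y - indicator {..x} y * u y \<partial>\<mu>)"
    unfolding set_lebesgue_integral_def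
    by (intro Bochner_Integration.integral_cong) (auto simp: indicator_def)
  then show ?thesis
    using Bochner_Integration.integral_diff[OF int I] by (simp add: set_lebesgue_integral_def)
qed

text \<open>As \<open>u\<close> has mean 0, either branch of \<open>T_op\<close> vanishes exactly
  where the primitive \<open>H\<close> does. The set where \<open>H\<close> is nonzero is open and
  null, hence empty, and differentiating \<open>H = 0\<close> gives \<open>f x * u x = 0\<close>
  almost everywhere. This settles the case of a vanishing norm in \<open>cov_bounds\<close>.\<close>

lemma T_op_eq_0_imp:
  assumes u: "u \<in> borel_measurable borel" and int: "integrable \<mu> u" and mean: "(\<integral>y. u y \<partial>\<mu>) = 0"
    and T: "AE x in \<mu>. T_op \<mu> (ereal m) u x = 0"
  shows "AE x in \<mu>. u x = 0"
proof -
  define H where "H x = (LINT y:{..x}|\<mu>. u y)" for x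
  have cont: "continuous_on UNIV H"
    unfolding H_def by (rule primitive_continuous[OF u int])
  have "AE x in lborel. H x = 0"
    using T unfolding AE_iff_lborel
  proof eventually_elim
    case (elim x)
    show ?case
      using elim cdf_pos[of x] cdf_less_1[of x] integral_greaterThan[OF u int, of x] mean
      by (auto simp: T_op_eq H_def split: if_splits)
  qed
  then have "AE x in lebesgue. x \<notin> {x. H x \<noteq> 0}"
    by (intro AE_completion) simp
  then have "negligible {x. H x \<noteq> 0}"
    by (simp add: negligible_iff_null_sets completion.AE_iff_null_sets)
  moreover have "open {x. H x \<noteq> 0}"
    using open_Collect_neq[OF cont continuous_on_const] .
  ultimately have "{x. H x \<noteq> 0} = {}"
    using open_not_negligible by blast
  then have H0: "H = (\<lambda>_. 0)" by auto
  have "AE x in lborel. u x = 0"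
    using primitive_deriv_AE[OF u int]
  proof eventually_elim
    case (elim x)
    then have "(H has_real_derivative f x * u x) (at x)" by (simp add: H_def[abs_def])
    then have "f x * u x = 0"
      unfolding H0 using DERIV_unique DERIV_const by blast
    then show ?case using f_pos[of x] by simp
  qed
  then show ?thesis by (simp add: AE_iff_lborel)
qed

section \<open>The exchange of integrals\<close>

text \<open>The denominator in \<open>T_op\<close>, split at \<open>m\<close> in the same way, so
  that the product with \<open>T_op\<close> is a plain tail integral. For a median \<open>m\<close>
  it is the minimum of \<open>F\<close> and \<open>1 - F\<close>.\<close>

definition tail_mass :: "real \<Rightarrow> real \<Rightarrow> real" where
  "tail_mass m t = (if t \<le> m then cdf \<mu> t else 1 - cdf \<mu> t)"

lemma tail_mass_pos: "0 < tail_mass m t"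
  using cdf_pos[of t] cdf_less_1[of t] by (simp add: tail_mass_def)

lemma tail_mass_measurable[measurable]: "tail_mass m \<in> borel_measurable borel"
  unfolding tail_mass_def[abs_def] by measurable

text \<open>Here the median enters: \<open>F\<close> is at most one half up to \<open>m\<close> and
  larger beyond, so each branch of \<open>tail_mass\<close> is the smaller of the two tails.\<close>

lemma tail_mass_le:
  assumes m: "is_median \<mu> m" and c: "Is_const \<mu> \<noteq> 0"
  shows "AE t in lborel. ennreal (tail_mass m t) \<le> inverse (Is_const \<mu>) * ennreal (f t)"
  using isoperimetric_density[OF isoperimetric_Is_const]
proof eventually_elim
  case (elim t)
  have "tail_mass m t = min (cdf \<mu> t) (1 - cdf \<mu> t)"
    using cdf_median[OF m] cdf_le_iff[of t m] cdf_less_iff[of m t] by (auto simp: tail_mass_def)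
  with elim have "Is_const \<mu> * ennreal (tail_mass m t) \<le> ennreal (f t)" by simp
  then have "inverse (Is_const \<mu>) * (Is_const \<mu> * ennreal (tail_mass m t)) \<le> inverse (Is_const \<mu>) * ennreal (f t)"
    by (rule mult_left_mono) simp
  moreover have "inverse (Is_const \<mu>) * Is_const \<mu> = 1"
    using c Is_const_finite
    by (cases "Is_const \<mu>") (auto simp: inverse_ennreal ennreal_mult'[symmetric])
  ultimately show ?case by (simp add: mult.assoc[symmetric])
qed

text \<open>Trading the tail mass for \<open>f\<close> turns Lebesgue measure into \<mu>. The
  function \<open>v\<close> is left free because \<open>abs_cov_le\<close> takes it once as the
  average of \<open>\<bar>u x\<bar>\<close>, to justify Fubini, and once as the average of
  \<open>u\<close>, for the estimate.\<close>

lemma weighted_holder: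
  fixes \<gamma> v :: "real \<Rightarrow> real"
  assumes pq: "1 \<le> p" "p < \<infinity>" "inverse p + inverse q = 1"
    and m: "is_median \<mu> m" and c: "Is_const \<mu> \<noteq> 0"
    and [measurable]: "\<gamma> \<in> borel_measurable borel" "v \<in> borel_measurable borel"
  shows "(\<integral>\<^sup>+t. ennreal (\<bar>\<gamma> t\<bar> * (tail_mass m t * \<bar>v t\<bar>)) \<partial>lborel)
    \<le> inverse (Is_const \<mu>) * Lp_norm \<mu> p \<gamma> * Lp_norm \<mu> q v"
proof -
  have "(\<integral>\<^sup>+t. ennreal (\<bar>\<gamma> t\<bar> * (tail_mass m t * \<bar>v t\<bar>)) \<partial>lborel)
      \<le> (\<integral>\<^sup>+t. inverse (Is_const \<mu>) * (ennreal (f t) * ennreal \<bar>\<gamma> t * v t\<bar>) \<partial>lborel)"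
  proof (rule nn_integral_mono_AE)
    show "AE t in lborel. ennreal (\<bar>\<gamma> t\<bar> * (tail_mass m t * \<bar>v t\<bar>)) \<le> inverse (Is_const \<mu>) * (ennreal (f t) * ennreal \<bar>\<gamma> t * v t\<bar>)"
      using tail_mass_le[OF m c]
    proof eventually_elim
      case (elim t)
      have "ennreal (\<bar>\<gamma> t\<bar> * (tail_mass m t * \<bar>v t\<bar>)) = ennreal (tail_mass m t) * ennreal \<bar>\<gamma> t * v t\<bar>"
        using tail_mass_pos[of m t] by (simp add: ennreal_mult'[symmetric] abs_mult ac_simps less_imp_le)
      also have "\<dots> \<le> (inverse (Is_const \<mu>) * ennreal (f t)) * ennreal \<bar>\<gamma> t * v t\<bar>"
        using elim by (rule mult_right_mono) simp
      finally show ?case by (simp add: mult.assoc)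
    qed
  qed
  also have "\<dots> = inverse (Is_const \<mu>) * (\<integral>\<^sup>+t. ennreal (f t) * ennreal \<bar>\<gamma> t * v t\<bar> \<partial>lborel)"
    by (rule nn_integral_cmult) measurable
  also have "(\<integral>\<^sup>+t. ennreal (f t) * ennreal \<bar>\<gamma> t * v t\<bar> \<partial>lborel) = (\<integral>\<^sup>+t. ennreal \<bar>\<gamma> t * v t\<bar> \<partial>\<mu>)"
    by (rule nn_integral_eq_lborel[symmetric]) measurable
  also have "\<dots> \<le> Lp_norm \<mu> p \<gamma> * Lp_norm \<mu> q v"
    by (rule Lp_norm_holder[OF pq]) measurable
  finally show ?thesis by (simp add: mult_left_mono mult.assoc)
qed

lemma integral_rearrangement_kernel:
  fixes u :: "real \<Rightarrow> real"
  shows "(\<integral>x. rearrangement_kernel m t x * u x \<partial>\<mu>)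
      = (if t \<le> m then -1 else 1) * (tail_mass m t * T_op \<mu> (ereal m) u t)"
proof (cases "t \<le> m")
  case True
  have "(\<integral>x. rearrangement_kernel m t x * u x \<partial>\<mu>) = (\<integral>x. - (indicator {..t} x * u x) \<partial>\<mu>)"
    using True by (intro Bochner_Integration.integral_cong) (auto simp: rearrangement_kernel_def indicator_def)
  then show ?thesis
    using True cdf_pos[of t] by (simp add: tail_mass_def T_op_eq set_lebesgue_integral_def)
next
  case False
  have "(\<integral>x. rearrangement_kernel m t x * u x \<partial>\<mu>) = (\<integral>x. indicator {t<..} x * u x \<partial>\<mu>)"
    using False by (intro Bochner_Integration.integral_cong) (auto simp: rearrangement_kernel_def indicator_def)
  then show ?thesis
    using False cdf_less_1[of t] by (simp add: tail_mass_def T_op_eq set_lebesgue_integral_def)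
qed

text \<open>Absolute values under the integral make \<open>T_op\<close> act on
  \<open>\<bar>u x\<bar>\<close>, with all cancellation lost; finiteness must then come from Hardy's
  inequality.\<close>

lemma nn_integral_rearrangement_kernel:
  fixes u :: "real \<Rightarrow> real"
  assumes u: "u \<in> borel_measurable borel" and int: "integrable \<mu> u"
  shows "(\<integral>\<^sup>+x. ennreal \<bar>rearrangement_kernel m t x * u x\<bar> \<partial>\<mu>)
      = ennreal (tail_mass m t * \<bar>T_op \<mu> (ereal m) (\<lambda>x. \<bar>u x\<bar>) t\<bar>)"
proof (cases "t \<le> m")
  case True
  have "(\<integral>\<^sup>+x. ennreal \<bar>rearrangement_kernel m t x * u x\<bar> \<partial>\<mu>) = (\<integral>\<^sup>+x. ennreal (indicator {..t} x * \<bar>u x\<bar>) \<partial>\<mu>)"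
    using True by (intro nn_integral_cong) (auto simp: rearrangement_kernel_def indicator_def)
  also have "\<dots> = ennreal (LINT y:{..t}|\<mu>. \<bar>u y\<bar>)"
    by (rule abs_set_integral_le(2)[OF u int]) measurable
  moreover have "0 \<le> (LINT y:{..t}|\<mu>. \<bar>u y\<bar>)"
    unfolding set_lebesgue_integral_def by (intro Bochner_Integration.integral_nonneg) simp
  ultimately show ?thesis
    using True cdf_pos[of t] by (simp add: tail_mass_def T_op_eq abs_divide)
next
  case False
  have "(\<integral>\<^sup>+x. ennreal \<bar>rearrangement_kernel m t x * u x\<bar> \<partial>\<mu>) = (\<integral>\<^sup>+x. ennreal (indicator {t<..} x * \<bar>u x\<bar>) \<partial>\<mu>)"
    using False by (intro nn_integral_cong) (auto simp: rearrangement_kernel_def indicator_def)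
  also have "\<dots> = ennreal (LINT y:{t<..}|\<mu>. \<bar>u y\<bar>)"
    by (rule abs_set_integral_le(2)[OF u int]) measurable
  moreover have "0 \<le> (LINT y:{t<..}|\<mu>. \<bar>u y\<bar>)"
    unfolding set_lebesgue_integral_def by (intro Bochner_Integration.integral_nonneg) simp
  ultimately show ?thesis
    using False cdf_less_1[of t] by (simp add: tail_mass_def T_op_eq abs_divide)
qed

lemma integral_kernel_primitive:
  assumes g: "abs_cont g"
  shows "(\<integral>t. quotient_limit g t * rearrangement_kernel m t x \<partial>lborel) = g x - g m"
proof -
  have [measurable]: "quotient_limit g \<in> borel_measurable borel"
    by (rule borel_measurable_quotient_limit[OF abs_cont_imp_continuous[OF g]])
  have [measurable]: "(\<lambda>t. rearrangement_kernel m t x) \<in> borel_measurable borel"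
    unfolding rearrangement_kernel_def by measurable
  show ?thesis
  proof (cases "x \<le> m")
    case True
    have "(\<integral>t. quotient_limit g t * rearrangement_kernel m t x \<partial>lborel) = (\<integral>t. - (indicator {x..m} t * quotient_limit g t) \<partial>lborel)"
      using True by (intro Bochner_Integration.integral_cong) (auto simp: rearrangement_kernel_def indicator_def)
    then show ?thesis
      using abs_cont_fundamental(3)[OF g True] by (simp add: set_lebesgue_integral_def)
  next
    case False
    \<comment> \<open>For \<open>m < x\<close> the kernel is 1 on the open interval only, hence
      equality almost everywhere; for \<open>x \<le> m\<close> it is -1 on exactly
      \<open>{x..m}\<close>.\<close>
    have "AE t in lborel. quotient_limit g t * rearrangement_kernel m t x = indicator {m..x} t * quotient_limit g t"
      using AE_lborel_singleton[of x] AE_lborel_singleton[of m]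
      by eventually_elim (use False in \<open>auto simp: rearrangement_kernel_def indicator_def\<close>)
    then have "(\<integral>t. quotient_limit g t * rearrangement_kernel m t x \<partial>lborel) = (\<integral>t. indicator {m..x} t * quotient_limit g t \<partial>lborel)"
      by (intro integral_cong_AE) measurable
    then show ?thesis
      using abs_cont_fundamental(3)[OF g, of m x] False by (simp add: set_lebesgue_integral_def)
  qed
qed

lemma abs_cov_le:
  assumes m: "is_median \<mu> m" and pq: "1 \<le> p" "p < \<infinity>" "inverse p + inverse q = 1"
    and g: "abs_cont g" and h: "h \<in> Lp_space \<mu> q"
    and c: "Is_const \<mu> \<noteq> 0" and gfin: "Lp_norm \<mu> p (quotient_limit g) < \<infinity>"
  shows "ennreal \<bar>cov \<mu> g h\<bar> \<le> inverse (Is_const \<mu>) * Lp_norm \<mu> p (quotient_limit g)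
      * Lp_norm \<mu> q (T_op \<mu> (ereal m) (centered \<mu> h))"
proof -
  define \<gamma> where "\<gamma> = quotient_limit g"
  define u where "u = centered \<mu> h"
  have hm: "h \<in> borel_measurable borel" and hi: "integrable \<mu> h"
    using Lp_space_imp_integrable[OF pq h] by auto
  have \<gamma>m[measurable]: "\<gamma> \<in> borel_measurable borel"
    unfolding \<gamma>_def by (rule borel_measurable_quotient_limit[OF abs_cont_imp_continuous[OF g]])
  have um[measurable]: "u \<in> borel_measurable borel"
    using hm unfolding u_def centered_def[abs_def] by measurable
  have ui: "integrable \<mu> u" and u0: "(\<integral>x. u x \<partial>\<mu>) = 0"
    using integral_centered[OF hi] by (simp_all add: u_def)
  have ufin: "Lp_norm \<mu> q u < \<infinity>"
    unfolding u_def by (rule Lp_norm_centered_finite[OF pq h])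
  have Tm[measurable]: "T_op \<mu> (ereal m) v \<in> borel_measurable borel" if "v \<in> borel_measurable borel" for v
    using that by (rule T_op_measurable)
  interpret L: pair_sigma_finite lborel \<mu>
    by (intro pair_sigma_finite.intro sigma_finite_lborel sigma_finite_measure_axioms)
  define K where "K t x = \<gamma> t * (rearrangement_kernel m t x * u x)" for t x
  have Kc: "rearrangement_kernel m t \<in> borel_measurable borel" for t
    unfolding rearrangement_kernel_def[abs_def] by measurable
  have Km: "case_prod K \<in> borel_measurable (lborel \<Otimes>\<^sub>M \<mu>)"
    unfolding K_def rearrangement_kernel_def by measurable
  have absu: "Lp_norm \<mu> q (\<lambda>x. \<bar>u x\<bar>) = Lp_norm \<mu> q u"
    by (simp add: Lp_norm_def)
  \<comment> \<open>Absolute integrability of \<open>K\<close>: Tonelli's theorem,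
    \<open>weighted_holder\<close> for the average of \<open>\<bar>u x\<bar>\<close>, then Hardy's
    inequality.\<close>
  have "(\<integral>\<^sup>+z. ennreal (norm (case_prod K z)) \<partial>(lborel \<Otimes>\<^sub>M \<mu>))
      = (\<integral>\<^sup>+t. \<integral>\<^sup>+x. ennreal (norm (K t x)) \<partial>\<mu> \<partial>lborel)"
    using Km by (subst nn_integral_fst[symmetric]) auto
  also have "\<dots> = (\<integral>\<^sup>+t. ennreal (\<bar>\<gamma> t\<bar> * (tail_mass m t * \<bar>T_op \<mu> (ereal m) (\<lambda>x. \<bar>u x\<bar>) t\<bar>)) \<partial>lborel)"
  proof (rule nn_integral_cong)
    fix t
    have "(\<integral>\<^sup>+x. ennreal (norm (K t x)) \<partial>\<mu>) = (\<integral>\<^sup>+x. ennreal \<bar>\<gamma> t\<bar> * ennreal \<bar>rearrangement_kernel m t x * u x\<bar> \<partial>\<mu>)"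
      by (intro nn_integral_cong) (simp add: K_def abs_mult ennreal_mult'[symmetric])
    also have "\<dots> = ennreal \<bar>\<gamma> t\<bar> * (\<integral>\<^sup>+x. ennreal \<bar>rearrangement_kernel m t x * u x\<bar> \<partial>\<mu>)"
      by (rule nn_integral_cmult) (use Kc um in measurable)
    finally show "(\<integral>\<^sup>+x. ennreal (norm (K t x)) \<partial>\<mu>) = ennreal (\<bar>\<gamma> t\<bar> * (tail_mass m t * \<bar>T_op \<mu> (ereal m) (\<lambda>x. \<bar>u x\<bar>) t\<bar>))"
      unfolding nn_integral_rearrangement_kernel[OF um ui] by (simp add: ennreal_mult')
  qed
  also have "\<dots> \<le> inverse (Is_const \<mu>) * Lp_norm \<mu> p \<gamma> * Lp_norm \<mu> q (T_op \<mu> (ereal m) (\<lambda>x. \<bar>u x\<bar>))"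
    by (rule weighted_holder[OF pq m c]) measurable
  also have "\<dots> \<le> inverse (Is_const \<mu>) * Lp_norm \<mu> p \<gamma> * (p * Lp_norm \<mu> q u)"
    unfolding absu[symmetric]
    by (intro mult_left_mono T_op_hardy[OF pq]) (use ui in auto)
  also have "\<dots> < \<infinity>"
  proof -
    have "inverse (Is_const \<mu>) < \<infinity>" using c
      by (cases "Is_const \<mu>") (auto simp: inverse_ennreal)
    then show ?thesis using gfin ufin pq(2) by (simp add: \<gamma>_def ennreal_mult_less_top)
  qed
  finally have Kint: "integrable (lborel \<Otimes>\<^sub>M \<mu>) (case_prod K)"
    using Km by (intro integrableI_bounded) auto
  have inner: "(\<integral>t. K t x \<partial>lborel) = (g x - g m) * u x" for x
  proof -
    have "(\<integral>t. K t x \<partial>lborel) = (\<integral>t. u x * (\<gamma> t * rearrangement_kernel m t x) \<partial>lborel)"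
      by (simp add: K_def ac_simps)
    then show ?thesis using integral_kernel_primitive[OF g, of m x] by (simp add: \<gamma>_def)
  qed
  have int1: "integrable \<mu> (\<lambda>x. (g x - g m) * u x)"
    using L.integrable_snd[OF Kint] by (simp add: inner)
  \<comment> \<open>Since \<open>u\<close> has mean 0, subtracting \<open>g m\<close> does not
    change the covariance; integrability of the first summand is a by-product of Fubini's
    theorem.\<close>
  have "cov \<mu> g h = (\<integral>x. (g x - g m) * u x + g m * u x \<partial>\<mu>)"
    by (simp add: cov_def u_def[symmetric] algebra_simps)
  also have "\<dots> = (\<integral>x. (g x - g m) * u x \<partial>\<mu>)"
    using int1 ui u0 by simp
  also have "\<dots> = (\<integral>x. \<integral>t. K t x \<partial>lborel \<partial>\<mu>)" by (simp add: inner)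
  also have "\<dots> = (\<integral>t. \<integral>x. K t x \<partial>\<mu> \<partial>lborel)"
    by (rule L.Fubini_integral[OF Kint])
  finally have cov: "cov \<mu> g h = (\<integral>t. \<integral>x. K t x \<partial>\<mu> \<partial>lborel)" .
  have outer: "\<bar>\<integral>x. K t x \<partial>\<mu>\<bar> = \<bar>\<gamma> t\<bar> * (tail_mass m t * \<bar>T_op \<mu> (ereal m) u t\<bar>)" for t
    using tail_mass_pos[of m t] by (simp add: K_def integral_rearrangement_kernel abs_mult)
  have "ennreal \<bar>cov \<mu> g h\<bar> \<le> (\<integral>\<^sup>+t. ennreal \<bar>\<integral>x. K t x \<partial>\<mu>\<bar> \<partial>lborel)"
    using integral_norm_bound_ennreal[OF L.integrable_fst[OF Kint]] by (simp add: cov)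
  also have "\<dots> \<le> inverse (Is_const \<mu>) * Lp_norm \<mu> p \<gamma> * Lp_norm \<mu> q (T_op \<mu> (ereal m) u)"
    unfolding outer by (rule weighted_holder[OF pq m c]) measurable
  finally show ?thesis by (simp add: \<gamma>_def u_def)
qed

lemma cov_bounds:
  assumes m: "is_median \<mu> m" and pq: "1 \<le> p" "p < \<infinity>" "inverse p + inverse q = 1"
    and g: "abs_cont g" and h: "h \<in> Lp_space \<mu> q"
  shows "ennreal \<bar>cov \<mu> g h\<bar> \<le> inverse (Is_const \<mu>) * Lp_norm \<mu> p (deriv g)
      * Lp_norm \<mu> q (T_op \<mu> (ereal m) (centered \<mu> h))"
    and "ennreal \<bar>cov \<mu> g h\<bar> \<le> p * inverse (Is_const \<mu>) * Lp_norm \<mu> p (deriv g) * Lp_norm \<mu> q (centered \<mu> h)"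
proof -
  define \<gamma> where "\<gamma> = quotient_limit g"
  have hm: "h \<in> borel_measurable borel" and hi: "integrable \<mu> h"
    using Lp_space_imp_integrable[OF pq h] by auto
  have um: "centered \<mu> h \<in> borel_measurable borel"
    using hm unfolding centered_def[abs_def] by measurable
  have \<gamma>m[measurable]: "\<gamma> \<in> borel_measurable borel"
    unfolding \<gamma>_def by (rule borel_measurable_quotient_limit[OF abs_cont_imp_continuous[OF g]])
  have pq0: "0 < p" "0 < q"
    using pq by (auto simp: zero_less_iff_neq_zero)
  have "AE x in \<mu>. deriv g x = \<gamma> x"
    unfolding AE_iff_lborel \<gamma>_def by (rule abs_cont_deriv_AE[OF g])
  \<comment> \<open>Measurability of \<open>deriv g\<close> is not invoked: nonnegative integrals of
    functions that are equal almost everywhere agree.\<close>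
  then have "(\<integral>\<^sup>+x. ennreal (\<bar>deriv g x\<bar> powr enn2real p) \<partial>\<mu>) = (\<integral>\<^sup>+x. ennreal (\<bar>\<gamma> x\<bar> powr enn2real p) \<partial>\<mu>)"
    by (intro nn_integral_cong_AE) (auto elim!: eventually_mono)
  then have norm: "Lp_norm \<mu> p (deriv g) = Lp_norm \<mu> p \<gamma>"
    using pq(2) by (cases "p = \<infinity>") (simp_all add: Lp_norm_def)
  let ?T = "T_op \<mu> (ereal m) (centered \<mu> h)"
  have main: "ennreal \<bar>cov \<mu> g h\<bar> \<le> inverse (Is_const \<mu>) * Lp_norm \<mu> p \<gamma> * Lp_norm \<mu> q ?T"
  proof -
    \<comment> \<open>Since \<open>0 * \<infinity> = 0\<close> in \<^typ>\<open>ennreal\<close>, the right-hand side is \<open>0\<close> in the first two cases even if another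
      factor is infinite, so the covariance has to vanish there.\<close>
    consider "Lp_norm \<mu> p \<gamma> = 0" | "Lp_norm \<mu> q ?T = 0"
      | "Lp_norm \<mu> p \<gamma> \<noteq> 0" "Lp_norm \<mu> q ?T \<noteq> 0" "Is_const \<mu> = 0 \<or> Lp_norm \<mu> p \<gamma> = \<infinity>"
      | "Is_const \<mu> \<noteq> 0" "Lp_norm \<mu> p \<gamma> < \<infinity>"
      using less_top[of "Lp_norm \<mu> p \<gamma>"] unfolding infinity_ennreal_def by blast
    then show ?thesis
    proof cases
      case 1
      then have "AE x in \<mu>. \<gamma> x = 0"
        by (intro Lp_norm_eq_0D[OF _ pq0(1)]) (auto cong: measurable_cong_sets)
      then have ae: "AE x in lborel. \<gamma> x = 0" by (simp add: AE_iff_lborel)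
      have "(LINT t:{x..y}|lborel. \<gamma> t) = 0" for x y
        unfolding set_lebesgue_integral_def
        using ae by (intro integral_eq_zero_AE) (auto elim!: eventually_mono)
      then have const: "g x = g y" if "x \<le> y" for x y
        using abs_cont_fundamental(3)[OF g that] by (simp add: \<gamma>_def)
      have "g x = g 0" for x
        using const[of x 0] const[of 0 x] by (cases "x \<le> 0") auto
      then have "cov \<mu> g h = 0" by (rule cov_eq_0_const[OF hm hi])
      then show ?thesis by simp
    next
      case 2
      then have "AE x in \<mu>. ?T x = 0"
        by (intro Lp_norm_eq_0D[OF _ pq0(2)]) (auto intro: T_op_measurable um cong: measurable_cong_sets)
      then have "AE x in \<mu>. centered \<mu> h x = 0"
        by (intro T_op_eq_0_imp[OF um integral_centered[OF hi]])
      then have "cov \<mu> g h = 0" by (rule cov_eq_0_AE[OF hm])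
      then show ?thesis by simp
    next
      case 3
      \<comment> \<open>All three factors on the right are now nonzero, so a single infinite one
        makes the bound trivial.\<close>
      have "inverse (Is_const \<mu>) \<noteq> 0" using Is_const_finite by simp
      with 3 have "inverse (Is_const \<mu>) * Lp_norm \<mu> p \<gamma> = \<infinity>"
        by (auto simp: ennreal_mult_eq_top_iff)
      with 3 show ?thesis by (simp add: ennreal_top_mult)
    next
      case 4
      then show ?thesis
        unfolding \<gamma>_def by (intro abs_cov_le[OF m pq g h])
    qed
  qed
  then show "ennreal \<bar>cov \<mu> g h\<bar> \<le> inverse (Is_const \<mu>) * Lp_norm \<mu> p (deriv g) * Lp_norm \<mu> q ?T"
    by (simp add: norm)
  also have "\<dots> \<le> inverse (Is_const \<mu>) * Lp_norm \<mu> p (deriv g) * (p * Lp_norm \<mu> q (centered \<mu> h))"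
    by (intro mult_left_mono T_op_hardy[OF pq um integral_centered(1)[OF hi]]) simp
  finally show "ennreal \<bar>cov \<mu> g h\<bar> \<le> p * inverse (Is_const \<mu>) * Lp_norm \<mu> p (deriv g) * Lp_norm \<mu> q (centered \<mu> h)"
    by (simp add: ac_simps)
qed

end

theorem theorem3p1:
  fixes \<mu> :: "real measure" and f g h :: "real \<Rightarrow> real" and m :: real and p q :: ennreal
  assumes "prob_space \<mu>"
    and "f \<in> borel_measurable borel" and "\<And>x. 0 < f x"
    and "\<mu> = density lborel (\<lambda>x. ennreal (f x))"
    and "is_median \<mu> m"
    and "1 \<le> p" and "p < \<infinity>" and "inverse p + inverse q = 1"
    and "g \<in> Lp_space \<mu> p" and "abs_cont g"
    and "h \<in> Lp_space \<mu> q" and "abs_cont h"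
  shows "ennreal \<bar>cov \<mu> g h\<bar>
           \<le> inverse (Is_const \<mu>) * Lp_norm \<mu> p (deriv g)
             * Lp_norm \<mu> q (T_op \<mu> (ereal m) (centered \<mu> h))
       \<and> ennreal \<bar>cov \<mu> g h\<bar>
           \<le> p * inverse (Is_const \<mu>) * Lp_norm \<mu> p (deriv g)
             * Lp_norm \<mu> q (centered \<mu> h)"
proof -
  interpret positive_density \<mu> f
    by (rule positive_density.intro) (fact assms)+
  show ?thesis
    by (intro conjI cov_bounds) (fact assms)+
qed

end
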